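(* Let $n,k\geq 1$. Define $\Theta:\mathcal{X}_n(k)\to\mathcal{Y}_n(k)$ by $\Theta(F,S)=(\Phi_{S_1}(F),S_2)$, where $S_1=S\cap\mathrm{Oint}(F)$ and $S_2=S\cap\mathrm{Si}^*(F)$, and define $\Theta':\mathcal{Y}_n(k)\to\mathcal{X}_n(k)$ by $\Theta'(F,S_1)=(\Phi_{S_2}(F),S_1\cup S_2)$, where $S_2=\mathrm{Yleaf}(F)$. Then $\Theta$ and $\Theta'$ are well defined and mutually inverse, hence give a bijection between $\mathcal{X}_n(k)$ and $\mathcal{Y}_n(k)$.
   Context: Trees: all trees are ordered (plane) rooted trees; the level of a node is its distance from the root (root at level 0); a leaf is a node with no children. An even $k$-ary tree is an ordered tree in which every node on an even level has exactly $k$ children. A pruned even $k$-ary tree is obtained from an even $k$-ary tree by deleting, for every even-level node all of whose children are leaves, all those children. An increasing pruned even $k$-ary tree on a set $M$ of positive integers is a pruned even $k$-ary tree whose nodes on even levels are labeled bijectively by $M$ (odd-level nodes unlabeled) such that labels increase along every path from the root downward and, for each node, the labels of its children increase from left to right. $\mathcal{F}_n(k)$ is the set of sequences $F=(T_1,\dots,T_m)$ of such trees whose label sets partition $[n]$ and whose root labels increase left to right. A labeled node is a leaf if it has no children and internal otherwise. A singleton is a one-node tree; $\mathrm{Si}(F)$ is the set of labels of singletons of $F$, and $\mathrm{Si}^*(F)$ is $\mathrm{Si}(F)$ minus the label of $T_m$ if $T_m$ is a singleton (otherwise $\mathrm{Si}^*(F)=\mathrm{Si}(F)$). For a labeled node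 $v$, its grand parent is the labeled node $u$ such that a child of $u$ is the parent of $v$. A labeled non-root node is old if its label is the greatest among all grand children of its grand parent, and young otherwise; roots are neither. $\mathrm{Oint}(F)$ is the set of labels of old internal nodes of $F$, $\mathrm{Yleaf}(F)$ the set of labels of young leaves. $\Phi_x$ on a tree $T$ (for a label $x$ of node $v$): (i) if $v$ is old internal, with grand parent $u$, children $\mu_1..\mu_k$ of $u$ and children $\nu_1..\nu_k$ of $v$ (left to right), delete each $\nu_j$ and attach the subtrees rooted at children of $\nu_j$ to $\mu_j$, ordering children of $\mu_j$ increasingly; (ii) if $v$ is a young leaf, with grand parent $u$ and children $\mu_1..\mu_k$ of $u$, let $F_j$ be the subtrees of $\mu_j$ whose root labels exceed $x$; attach $k$ new unlabeled children $\nu_1..\nu_k$ to $v$ and move the subtrees in $F_j$ to $\nu_j$, ordering increasingly; (iii) otherwise $\Phi_x(T)=T$. For a set $S$ of labels of $T$, $\Phi_S(T)$ is the composition of the $\Phi_x$, $x\in S$ (these commute when $S\subseteq\mathrm{Oint}(T)$ or $S\subseteq\mathrm{Yleaf}(T)$). For $F=(T_1,\dots,T_m)$ and $S\subseteq\mathrm{Oint}(F)$ or $S\subseteq\mathrm{Yleaf}(F)$, $\Phi_S(F)=(\Phi_{S_1}(T_1),\dots,\Phi_{S_m}(T_m))$ where $S_i$ is the set of elements of $S$ labeling nodes of $T_i$. $\mathcal{X}_n(k)=\{(F,S): F\in\mathcal{F}_n(k),\ F\text{ has no young leaves},\ S\subseteq\mathrm{Oint}(F)\cup\mathrm{Si}^*(F)\}$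 and $\mathcal{Y}_n(k)=\{(F,S): F\in\mathcal{F}_n(k),\ S\subseteq\mathrm{Si}^*(F)\}$. *)

theory Defs
  imports "HOL-Library.FuncSet"
begin

text \<open>
  Plane rooted trees, split by the parity of the level. A node on an even level is
  \<open>ENode x cs\<close>: it carries a label \<open>x\<close> and the left-to-right list \<open>cs\<close> of its children. These
  lie on an odd level, carry no label, and hence are nothing but the left-to-right list of the
  subtrees (rooted on the next even level) below them. An odd-level leaf is the empty list.
\<close>

datatype etree = ENode (lab: nat) (kids: "etree list list")

text \<open>Labeled nodes are represented by the subtrees rooted at them.\<close>

fun subtrees :: "etree \<Rightarrow> etree set" where
  "subtrees (ENode x cs) = insert (ENode x cs) (\<Union>c\<in>set cs. \<Union>t\<in>set c. subtrees t)"

fun labels :: "etree \<Rightarrow> nat list" where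
  "labels (ENode x cs) = x # concat (map (\<lambda>c. concat (map labels c)) cs)"

definition grand_children :: "etree \<Rightarrow> etree list" where
  "grand_children u = concat (kids u)"

definition leaf :: "etree \<Rightarrow> bool" where
  "leaf v \<longleftrightarrow> kids v = []"

definition internal :: "etree \<Rightarrow> bool" where
  "internal v \<longleftrightarrow> \<not> leaf v"

definition even_kary :: "nat \<Rightarrow> etree \<Rightarrow> bool" where
  "even_kary k T \<longleftrightarrow> (\<forall>v\<in>subtrees T. length (kids v) = k)"

fun prune :: "etree \<Rightarrow> etree" where
  "prune (ENode x cs) = ENode x (if \<forall>c\<in>set cs. c = [] then [] else map (map prune) cs)"

text \<open>Pruning deletes unlabeled nodes only, so the labels can be carried along.\<close>

definition pruned_even_kary :: "nat \<Rightarrow> etree set" where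
  "pruned_even_kary k = prune ` {T. even_kary k T}"

definition increasing :: "etree \<Rightarrow> bool" where
  "increasing T \<longleftrightarrow>
     (\<forall>v\<in>subtrees T. (\<forall>w\<in>set (grand_children v). lab v < lab w) \<and>
                     (\<forall>c\<in>set (kids v). sorted_wrt (<) (map lab c)))"

definition inc_trees :: "nat \<Rightarrow> nat set \<Rightarrow> etree set" where
  "inc_trees k M = {T \<in> pruned_even_kary k.
     distinct (labels T) \<and> set (labels T) = M \<and> 0 \<notin> M \<and> increasing T}"

definition forests :: "nat \<Rightarrow> nat \<Rightarrow> etree list set" where
  "forests n k = {F.
     (\<forall>T\<in>set F. T \<in> inc_trees k (set (labels T))) \<and>
     sorted_wrt (\<lambda>T U. set (labels T) \<inter> set (labels U) = {}) F \<and>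
     (\<Union>T\<in>set F. set (labels T)) = {1..n} \<and>
     sorted_wrt (<) (map lab F)}"

definition Si :: "etree list \<Rightarrow> nat set" where
  "Si F = {lab T | T. T \<in> set F \<and> leaf T}"

definition Si_star :: "etree list \<Rightarrow> nat set" where
  "Si_star F = (if leaf (last F) then Si F - {lab (last F)} else Si F)"

definition is_grand_parent :: "etree \<Rightarrow> etree \<Rightarrow> etree \<Rightarrow> bool" where
  "is_grand_parent T u v \<longleftrightarrow> u \<in> subtrees T \<and> v \<in> set (grand_children u)"

definition old :: "etree \<Rightarrow> etree \<Rightarrow> bool" where
  "old T v \<longleftrightarrow> (\<exists>u. is_grand_parent T u v \<and> (\<forall>w\<in>set (grand_children u). lab w \<le> lab v))"

definition young :: "etree \<Rightarrow> etree \<Rightarrow> bool" where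
  "young T v \<longleftrightarrow> (\<exists>u. is_grand_parent T u v \<and> \<not> (\<forall>w\<in>set (grand_children u). lab w \<le> lab v))"

definition Oint_tree :: "etree \<Rightarrow> nat set" where
  "Oint_tree T = {lab v | v. old T v \<and> internal v}"

definition Yleaf_tree :: "etree \<Rightarrow> nat set" where
  "Yleaf_tree T = {lab v | v. young T v \<and> leaf v}"

definition Oint :: "etree list \<Rightarrow> nat set" where
  "Oint F = (\<Union>T\<in>set F. Oint_tree T)"

definition Yleaf :: "etree list \<Rightarrow> nat set" where
  "Yleaf F = (\<Union>T\<in>set F. Yleaf_tree T)"

text \<open>Applies \<open>f\<close> to the subtree rooted at the grand parent of the node labeled \<open>x\<close>.\<close>

fun at_grand_parent :: "nat \<Rightarrow> (etree \<Rightarrow> etree) \<Rightarrow> etree \<Rightarrow> etree" where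
  "at_grand_parent x f (ENode a cs) =
     (if x \<in> lab ` set (grand_children (ENode a cs)) then f (ENode a cs)
      else ENode a (map (map (at_grand_parent x f)) cs))"

text \<open>
  In the next two functions the argument is the subtree rooted at the grand parent \<open>u\<close> of the
  node \<open>v\<close> labeled \<open>x\<close>. In the first, \<open>\<mu>\<close> and \<open>\<nu>\<close> run in parallel through the children of \<open>u\<close>
  and of \<open>v\<close>.
\<close>

definition lift_up :: "nat \<Rightarrow> etree \<Rightarrow> etree" where
  "lift_up x u =
     (let v = hd (filter (\<lambda>t. lab t = x) (grand_children u)) in
      ENode (lab u)
        (map2 (\<lambda>\<mu> \<nu>. sort_key lab (map (\<lambda>t. if lab t = x then ENode x [] else t) \<mu> @ \<nu>))
              (kids u) (kids v)))"

definition push_down :: "nat \<Rightarrow> etree \<Rightarrow> etree" where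
  "push_down x u =
     (let v = ENode x (map (\<lambda>\<mu>. sort_key lab (filter (\<lambda>t. x < lab t) \<mu>)) (kids u)) in
      ENode (lab u)
        (map (\<lambda>\<mu>. map (\<lambda>t. if lab t = x then v else t) (filter (\<lambda>t. \<not> x < lab t) \<mu>)) (kids u)))"

definition Phi :: "nat \<Rightarrow> etree \<Rightarrow> etree" where
  "Phi x T =
     (if x \<in> Oint_tree T then at_grand_parent x (lift_up x) T
      else if x \<in> Yleaf_tree T then at_grand_parent x (push_down x) T
      else T)"

text \<open>
  The fold over a finite set is meaningful only if the result does not depend on the order of
  composition, as is the case for \<open>S \<subseteq> Oint_tree T\<close> and for \<open>S \<subseteq> Yleaf_tree T\<close>.
\<close>

definition Phi_tree :: "nat set \<Rightarrow> etree \<Rightarrow> etree" where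
  "Phi_tree S T = Finite_Set.fold Phi T S"

definition Phi_forest :: "nat set \<Rightarrow> etree list \<Rightarrow> etree list" where
  "Phi_forest S F = map (\<lambda>T. Phi_tree (S \<inter> set (labels T)) T) F"

definition XX :: "nat \<Rightarrow> nat \<Rightarrow> (etree list \<times> nat set) set" where
  "XX n k = {(F, S). F \<in> forests n k \<and> Yleaf F = {} \<and> S \<subseteq> Oint F \<union> Si_star F}"

definition YY :: "nat \<Rightarrow> nat \<Rightarrow> (etree list \<times> nat set) set" where
  "YY n k = {(F, S). F \<in> forests n k \<and> S \<subseteq> Si_star F}"

definition Theta :: "etree list \<times> nat set \<Rightarrow> etree list \<times> nat set" where
  "Theta = (\<lambda>(F, S). (Phi_forest (S \<inter> Oint F) F, S \<inter> Si_star F))"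

definition Theta' :: "etree list \<times> nat set \<Rightarrow> etree list \<times> nat set" where
  "Theta' = (\<lambda>(F, S). (Phi_forest (Yleaf F) F, S \<union> Yleaf F))"

end

theory Submission
  imports Defs
begin

text \<open>
  An increasing pruned tree is determined by its root label together with the set of triples
  \<open>(u, j, w)\<close> saying that the node labeled \<open>w\<close> hangs below the \<open>j\<close>-th child of the node labeled \<open>u\<close>.
  In these terms \<open>Phi x\<close> only changes first components: if \<open>x\<close> is old internal with grand parent \<open>p\<close>,
  every source \<open>x\<close> becomes \<open>p\<close>; if \<open>x\<close> is a young leaf, the source \<open>p\<close> of every target exceeding \<open>x\<close>
  becomes \<open>x\<close>. Hence \<open>Phi x\<close> is an involution that moves \<open>x\<close> between the old internal nodes and the
  young leaves and leaves the status of all other labels alone, and any two such maps commute.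
  So \<open>Phi_forest S\<close> is an involution exchanging the two kinds of nodes within \<open>S\<close>, and singletons are
  untouched; both compositions of the theorem are then computations with sets of labels.
\<close>

section \<open>Trees as sets of grand-parent edges\<close>

text \<open>The local form of being an increasing pruned even \<open>k\<close>-ary tree;
  \<open>pruned_even_kary_iff\<close> identifies its first condition with membership in the image of
  \<open>prune\<close>. Distinctness of labels is kept apart because after a move it is derived from
  the edges.\<close>

definition regular :: "nat \<Rightarrow> etree \<Rightarrow> bool" where
  "regular k T \<longleftrightarrow>
     (\<forall>v\<in>subtrees T. kids v = [] \<or> length (kids v) = k \<and> grand_children v \<noteq> []) \<and> increasing T"

definition edges :: "etree \<Rightarrow> (nat \<times> nat \<times> nat) set" where
  "edges T = {(u, j, w). \<exists>v\<in>subtrees T. u = lab v \<and> j < length (kids v) \<and> w \<in> lab ` set (kids v ! j)}"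

text \<open>The edge-set counterpart of distinct labels: see \<open>functional_edges\<close> and
  \<open>distinct_labels_if_functional\<close>.\<close>

definition functional :: "(nat \<times> nat \<times> nat) set \<Rightarrow> bool" where
  "functional R \<longleftrightarrow> (\<forall>u i v j w. (u, i, w) \<in> R \<and> (v, j, w) \<in> R \<longrightarrow> u = v \<and> i = j)"

lemma in_set_concat_nth: "t \<in> set (concat cs) \<longleftrightarrow> (\<exists>j<length cs. t \<in> set (cs ! j))"
  unfolding set_concat UN_iff by (metis in_set_conv_nth)

lemma set_concat_nth: "set (concat cs) = (\<Union>j<length cs. set (cs ! j))"
  using in_set_concat_nth[of _ cs] by blast

lemma regular_ENode:
  "regular k (ENode a cs) \<longleftrightarrow>
     (cs = [] \<or> length cs = k \<and> concat cs \<noteq> []) \<and>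
     (\<forall>c\<in>set cs. sorted_wrt (<) (map lab c) \<and> (\<forall>t\<in>set c. a < lab t \<and> regular k t))"
  unfolding regular_def increasing_def by (auto simp: grand_children_def)

lemma edges_ENode:
  "(u, j, w) \<in> edges (ENode a cs) \<longleftrightarrow>
     u = a \<and> j < length cs \<and> w \<in> lab ` set (cs ! j) \<or> (\<exists>t\<in>set (concat cs). (u, j, w) \<in> edges t)"
  by (simp add: edges_def)

lemma self_in_subtrees [simp]: "T \<in> subtrees T"
  by (cases T) auto

lemma subtrees_trans: "u \<in> subtrees T \<Longrightarrow> v \<in> subtrees u \<Longrightarrow> v \<in> subtrees T"
  by (induction T) auto

lemma grand_child_in_subtrees:
  "u \<in> subtrees T \<Longrightarrow> v \<in> set (grand_children u) \<Longrightarrow> v \<in> subtrees T"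
  by (rule subtrees_trans[of u], simp, cases u) (auto simp: grand_children_def intro!: bexI)

lemma set_labels: "set (labels T) = lab ` subtrees T"
  by (induction T) (force simp: image_UN)

lemma lab_in_labels [simp]: "lab T \<in> set (labels T)"
  by (cases T) auto

text \<open>Consequently a map on edges that keeps targets, together with an unchanged root label,
  leaves the label set unchanged.\<close>

lemma set_labels_edges: "set (labels T) = insert (lab T) {w. \<exists>u j. (u, j, w) \<in> edges T}"
proof (induction T)
  case (ENode a cs)
  have "set (labels (ENode a cs)) =
      insert a (\<Union>t\<in>set (concat cs). insert (lab t) {w. \<exists>u j. (u, j, w) \<in> edges t})"
    using ENode by simp
  also have "\<dots> = insert a (lab ` set (concat cs) \<union> (\<Union>t\<in>set (concat cs). {w. \<exists>u j. (u, j, w) \<in> edges t}))"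
    by blast
  also have "lab ` set (concat cs) = {w. \<exists>j<length cs. w \<in> lab ` set (cs ! j)}"
    using in_set_concat_nth[of _ cs] by blast
  finally show ?case unfolding set_eq_iff by (simp add: edges_ENode) blast
qed

lemma edge_source: "(u, j, w) \<in> edges T \<Longrightarrow> u \<in> set (labels T)"
  unfolding edges_def set_labels by auto

lemma edge_target: "(u, j, w) \<in> edges T \<Longrightarrow> w \<in> set (labels T)"
  unfolding set_labels_edges by blast

lemma edge_less: "regular k T \<Longrightarrow> (u, j, w) \<in> edges T \<Longrightarrow> u < w"
  unfolding regular_def increasing_def edges_def grand_children_def by fastforce

lemma lab_le_labels: "regular k T \<Longrightarrow> w \<in> set (labels T) \<Longrightarrow> lab T \<le> w"
proof (induction T)
  case (ENode a cs)
  then show ?case by (fastforce simp: regular_ENode)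
qed

section \<open>Distinct labels versus functional edge sets\<close>

lemma labels_ENode: "labels (ENode a cs) = a # concat (map labels (concat cs))"
  by (induction cs) auto

lemma labels_nonempty [simp]: "labels T \<noteq> []"
  by (cases T) auto

lemma distinct_labels_ENode:
  assumes "distinct (labels (ENode a cs))"
  shows "\<And>t. t \<in> set (concat cs) \<Longrightarrow> a \<notin> set (labels t)"
    and "\<And>t. t \<in> set (concat cs) \<Longrightarrow> distinct (labels t)"
    and "\<And>t t'. t \<in> set (concat cs) \<Longrightarrow> t' \<in> set (concat cs) \<Longrightarrow> t \<noteq> t' \<Longrightarrow>
           set (labels t) \<inter> set (labels t') = {}"
    and "distinct (concat cs)"
proof -
  have d: "distinct (concat (map labels (concat cs)))" "a \<notin> set (concat (map labels (concat cs)))"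
    using assms unfolding labels_ENode by auto
  show "\<And>t. t \<in> set (concat cs) \<Longrightarrow> a \<notin> set (labels t)" using d(2) by auto
  show "\<And>t. t \<in> set (concat cs) \<Longrightarrow> distinct (labels t)"
    using d(1) unfolding distinct_concat_iff by auto
  \<comment> \<open>\<open>distinct_concat_iff\<close> exempts repeated empty blocks from
    distinctness. Label lists are never empty, so the exemption is vacuous and distinct
    grandchildren have distinct label lists.\<close>
  have "removeAll [] (map labels (concat cs)) = map labels (concat cs)"
    by (rule removeAll_id) (auto dest: sym)
  with d(1) have m: "distinct (map labels (concat cs))"
    unfolding distinct_concat_iff by simp
  then show "distinct (concat cs)" unfolding distinct_map by blast
  show "set (labels t) \<inter> set (labels t') = {}"
    if "t \<in> set (concat cs)" "t' \<in> set (concat cs)" "t \<noteq> t'" for t t'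
  proof -
    have "labels t \<noteq> labels t'" using m that unfolding distinct_map inj_on_def by blast
    then show ?thesis using d(1) that unfolding distinct_concat_iff by auto
  qed
qed

lemma distinct_concat_index:
  "distinct (concat xs) \<Longrightarrow> i < length xs \<Longrightarrow> j < length xs \<Longrightarrow> x \<in> set (xs ! i) \<Longrightarrow> x \<in> set (xs ! j) \<Longrightarrow> i = j"
proof (induction xs arbitrary: i j)
  case (Cons c cs)
  have "x \<notin> set (cs ! m)" if "x \<in> set c" "m < length cs" for m
    using that Cons.prems(1) nth_mem by fastforce
  with Cons show ?case by (cases i; cases j) auto
qed simp

lemma distinct_concatI:
  assumes "\<And>i. i < length xs \<Longrightarrow> distinct (xs ! i)"
    and "\<And>i j x. i < length xs \<Longrightarrow> j < length xs \<Longrightarrow> x \<in> set (xs ! i) \<Longrightarrow> x \<in> set (xs ! j) \<Longrightarrow> i = j"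
  shows "distinct (concat xs)"
  using assms
proof (induction xs)
  case (Cons c cs)
  have "distinct (concat cs)"
    by (rule Cons.IH) (use Cons.prems(1)[of "Suc _"] Cons.prems(2)[of "Suc _" "Suc _"] in auto)
  moreover have "set c \<inter> set (concat cs) = {}"
    using Cons.prems(2)[of 0 "Suc _"] by (auto simp: in_set_conv_nth[of _ cs])
  ultimately show ?case using Cons.prems(1)[of 0] by simp
qed simp

text \<open>Justifies identifying nodes with their labels. Different grandchildren of the root have
  disjoint label sets, so a shared label places both nodes in one branch, where induction
  applies.\<close>

lemma inj_on_lab_subtrees: "distinct (labels T) \<Longrightarrow> inj_on lab (subtrees T)"
proof (induction T)
  case (ENode a cs)
  note D = distinct_labels_ENode[OF ENode.prems]
  show ?case
  proof (rule inj_onI)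
    fix v w assume vw: "v \<in> subtrees (ENode a cs)" "w \<in> subtrees (ENode a cs)" "lab v = lab w"
    have root: "u = ENode a cs" if "u \<in> subtrees (ENode a cs)" "lab u = a" for u
      using that D(1) set_labels by fastforce
    show "v = w"
    proof (cases "lab v = a")
      case True then show ?thesis using root vw by metis
    next
      case False
      then obtain s t where st: "s \<in> set (concat cs)" "v \<in> subtrees s" "t \<in> set (concat cs)" "w \<in> subtrees t"
        using vw by auto
      then have "s = t" using D(3)[of s t] vw(3) set_labels by (metis disjoint_iff imageI)
      then show ?thesis using st ENode.IH D(2) vw(3) unfolding inj_on_def by auto
    qed
  qed
qed

lemma edge_not_to_root:
  assumes "distinct (labels T)" shows "(u, i, lab T) \<notin> edges T"
proof (cases T)
  case (ENode a cs)
  note D = distinct_labels_ENode[OF assms[unfolded ENode]]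
  have "(u, i, w) \<in> edges (ENode a cs) \<Longrightarrow> w \<noteq> a" for u i w
    using D(1) unfolding edges_ENode by (auto dest: edge_target) (metis lab_in_labels nth_mem)
  then show ?thesis unfolding ENode by auto
qed

text \<open>Two edges with a common target either both leave the root or both lie in one branch,
  since branches have disjoint labels. In the mixed case the root of a branch would be a target
  inside that branch.\<close>

lemma functional_edges: "distinct (labels T) \<Longrightarrow> functional (edges T)"
proof (induction T)
  case (ENode a cs)
  note D = distinct_labels_ENode[OF ENode.prems]
  have IH: "functional (edges t)" if "t \<in> set (concat cs)" for t
    using ENode.IH D(2) that by auto
  have mix: False if "t \<in> set (concat cs)" "s \<in> set (concat cs)" "(u, i, lab s) \<in> edges t" for s t u i
  proof -
    have "s = t" using D(3)[OF that(1,2)] edge_target[OF that(3)] lab_in_labels by blast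
    then show False using that edge_not_to_root D(2) by blast
  qed
  show ?case unfolding functional_def
  proof (intro allI impI, elim conjE)
    fix u i v j w assume A: "(u, i, w) \<in> edges (ENode a cs)" "(v, j, w) \<in> edges (ENode a cs)"
    have split: "(\<exists>s. u = a \<and> i < length cs \<and> s \<in> set (cs ! i) \<and> w = lab s) \<or>
        (\<exists>s\<in>set (concat cs). (u, i, w) \<in> edges s)" if "(u, i, w) \<in> edges (ENode a cs)" for u i
      using that unfolding edges_ENode by blast
    have sub: "s \<in> set (concat cs)" if "i < length cs" "s \<in> set (cs ! i)" for i s
      using that by (auto intro: nth_mem)
    from split[OF A(1)] split[OF A(2)] show "u = v \<and> i = j"
    proof (elim disjE exE bexE conjE)
      fix s t assume *: "u = a" "v = a" "i < length cs" "s \<in> set (cs ! i)" "w = lab s"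
        "j < length cs" "t \<in> set (cs ! j)" "w = lab t"
      have "s = t" using D(3) sub * by (metis disjoint_iff lab_in_labels)
      then show ?thesis using distinct_concat_index[OF D(4)] * by auto
    next
      fix s t assume "s \<in> set (concat cs)" "t \<in> set (concat cs)" "(u, i, w) \<in> edges s" "(v, j, w) \<in> edges t"
      moreover from this have "s = t" using D(3)[of s t] edge_target by blast
      ultimately show ?thesis using IH unfolding functional_def by blast
    qed (use mix sub in blast)+
  qed
qed

text \<open>Converse of \<open>functional_edges\<close> for regular trees. A change of sources
  preserves functionality, so this yields distinct labels after \<open>Phi x\<close> without
  counting labels in the rearranged tree.\<close>

lemma distinct_labels_if_functional:
  "regular k T \<Longrightarrow> functional (edges T) \<Longrightarrow> distinct (labels T)"
proof (induction T)
  case (ENode a cs)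
  have child: "a < lab t" "regular k t" "distinct (labels t)" if "t \<in> set (concat cs)" for t
  proof -
    show "a < lab t" and *: "regular k t" using ENode.prems(1) that unfolding regular_ENode by auto
    have "functional (edges t)" using ENode.prems(2) that unfolding functional_def edges_ENode by blast
    then show "distinct (labels t)" using ENode.IH * that by auto
  qed
  have root_edge: "\<exists>j. (a, j, lab t) \<in> edges (ENode a cs)" if "t \<in> set (concat cs)" for t
    using that unfolding edges_ENode in_set_concat_nth by blast
  \<comment> \<open>Below one child the strict order separates labels; across children the position
    recorded in the edge from the root does.\<close>
  have d: "distinct (concat (map (map lab) cs))"
  proof (rule distinct_concatI)
    fix i assume "i < length (map (map lab) cs)"
    then have "sorted_wrt (<) (map lab (cs ! i))" using ENode.prems(1) unfolding regular_ENode by auto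
    then show "distinct (map (map lab) cs ! i)"
      using \<open>i < _\<close> by (simp add: strict_sorted_iff)
  next
    fix i j x assume *: "i < length (map (map lab) cs)" "j < length (map (map lab) cs)"
      "x \<in> set (map (map lab) cs ! i)" "x \<in> set (map (map lab) cs ! j)"
    then have "(a, i, x) \<in> edges (ENode a cs)" "(a, j, x) \<in> edges (ENode a cs)"
      unfolding edges_ENode by auto
    then show "i = j" using ENode.prems(2) unfolding functional_def by blast
  qed
  then have dm: "distinct (map lab (concat cs))" by (simp add: map_concat)
  have eq: "s = t" if "s \<in> set (concat cs)" "t \<in> set (concat cs)" "lab s = lab t" for s t
    using dm that unfolding distinct_map inj_on_def by blast
  \<comment> \<open>A label shared by two grandchildren has a unique source, which is a smaller shared label.\<close>
  have disj: "s = t" if st: "s \<in> set (concat cs)" "t \<in> set (concat cs)"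
    and "y \<in> set (labels s)" "y \<in> set (labels t)" for y s t
    using that(3,4)
  proof (induction y rule: less_induct)
    case (less y)
    \<comment> \<open>By functionality the root label \<open>a\<close> is the only source of
      \<open>lab s\<close>, but every label inside the branch \<open>t\<close> exceeds
      \<open>a\<close>.\<close>
    have mix: False if "s \<in> set (concat cs)" "t \<in> set (concat cs)" "(u, i, lab s) \<in> edges t" for s t u i
    proof -
      have "(u, i, lab s) \<in> edges (ENode a cs)" using that unfolding edges_ENode by blast
      with root_edge[OF that(1)] ENode.prems(2) have "u = a" unfolding functional_def by blast
      with edge_source[OF that(3)] lab_le_labels child that(2) show False by fastforce
    qed
    from less.prems consider "y = lab s" "y = lab t"
      | u i where "y = lab s" "(u, i, y) \<in> edges t" | u i where "y = lab t" "(u, i, y) \<in> edges s"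
      | u i v j where "(u, i, y) \<in> edges s" "(v, j, y) \<in> edges t"
      unfolding set_labels_edges by blast
    then show ?case
    proof cases
      case 1 then show ?thesis using eq st by simp
    next
      case 2 then show ?thesis using mix st by blast
    next
      case 3 then show ?thesis using mix st by blast
    next
      case (4 u i v j)
      have "(u, i, y) \<in> edges (ENode a cs)" "(v, j, y) \<in> edges (ENode a cs)"
        using 4 st unfolding edges_ENode by blast+
      then have "u = v" using ENode.prems(2) unfolding functional_def by blast
      moreover have "u < y" using edge_less child(2) 4(1) st by blast
      ultimately show ?thesis using less.IH edge_source 4 by blast
    qed
  qed
  have "distinct (map labels (concat cs))"
    unfolding distinct_map
  proof
    show "distinct (concat cs)" using dm by (simp add: distinct_map)
    show "inj_on labels (set (concat cs))"
      by (rule inj_onI) (metis disj lab_in_labels)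
  qed
  then have "distinct (concat (map labels (concat cs)))"
    unfolding distinct_concat_iff set_map using child(3) disj
    by (intro conjI allI impI; blast intro: distinct_removeAll)
  moreover have "a \<notin> set (concat (map labels (concat cs)))"
    using lab_le_labels child(1,2) by fastforce
  ultimately show ?case unfolding labels_ENode by simp
qed

section \<open>Recovering a tree from its edges\<close>

lemma out_edges:
  assumes "distinct (labels T)" "v \<in> subtrees T"
  shows "(lab v, j, w) \<in> edges T \<longleftrightarrow> j < length (kids v) \<and> w \<in> lab ` set (kids v ! j)"
  using assms inj_on_lab_subtrees[OF assms(1)] unfolding edges_def inj_on_def by blast

lemma regular_subtree: "regular k T \<Longrightarrow> v \<in> subtrees T \<Longrightarrow> regular k v"
  unfolding regular_def increasing_def using subtrees_trans by blast

text \<open>Regularity excludes a node that has children but no grandchildren; such a node would be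
  invisible in the edge set.\<close>

lemma kids_nonempty_iff:
  assumes "regular k T" "distinct (labels T)" "v \<in> subtrees T"
  shows "kids v \<noteq> [] \<longleftrightarrow> (\<exists>j w. (lab v, j, w) \<in> edges T)"
proof
  assume "kids v \<noteq> []"
  then have "grand_children v \<noteq> []" using assms(1,3) unfolding regular_def by blast
  then obtain w where "w \<in> set (concat (kids v))" unfolding grand_children_def by (meson list.set_sel(1))
  then show "\<exists>j w. (lab v, j, w) \<in> edges T"
    unfolding out_edges[OF assms(2,3)] in_set_concat_nth by blast
next
  assume "\<exists>j w. (lab v, j, w) \<in> edges T"
  then show "kids v \<noteq> []" unfolding out_edges[OF assms(2,3)] by auto
qed

text \<open>The tree is rebuilt from the root downward. Outgoing edges tell whether a node has
  children, regularity then fixes their number as \<open>k\<close>, and the labels below each child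
  form a known set whose order is forced by strict increase. Nodes with equal labels are therefore
  equal by induction on the subtree.\<close>

lemma tree_eqI:
  assumes "regular k T" "distinct (labels T)" "regular k T'" "distinct (labels T')"
    and "lab T = lab T'" "edges T = edges T'"
  shows "T = T'"
proof -
  have "v = v'" if "v \<in> subtrees T" "v' \<in> subtrees T'" "lab v = lab v'" for v v'
    using that
  proof (induction v arbitrary: v')
    case (ENode a cs)
    let ?v = "ENode a cs"
    have ne: "cs = [] \<longleftrightarrow> kids v' = []"
      using kids_nonempty_iff[OF assms(1,2) ENode.prems(1)] kids_nonempty_iff[OF assms(3,4) ENode.prems(2)]
        ENode.prems(3) assms(6) by auto
    have "length cs = length (kids v')"
      using ne assms(1,3) ENode.prems(1,2) unfolding regular_def by (metis etree.sel(2))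
    moreover have "cs ! j = kids v' ! j" if j: "j < length cs" "j < length (kids v')" for j
    proof -
      have "lab ` set (cs ! j) = lab ` set (kids v' ! j)"
        using out_edges[OF assms(2) ENode.prems(1), of j] out_edges[OF assms(4) ENode.prems(2), of j]
          ENode.prems(3) assms(6) j by auto
      moreover have "sorted_wrt (<) (map lab (cs ! j))" "sorted_wrt (<) (map lab (kids v' ! j))"
        using assms(1,3) ENode.prems(1,2) j nth_mem unfolding regular_def increasing_def
        by (metis etree.sel(2))+
      ultimately have m: "map lab (cs ! j) = map lab (kids v' ! j)"
        by (intro strict_sorted_equal) auto
      then have "length (cs ! j) = length (kids v' ! j)" using map_eq_imp_length_eq by blast
      then show ?thesis
      proof (rule nth_equalityI)
        fix i assume i: "i < length (cs ! j)"
        then have i': "i < length (kids v' ! j)" using m map_eq_imp_length_eq by metis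
        have "cs ! j ! i \<in> subtrees T"
          by (rule grand_child_in_subtrees[OF ENode.prems(1)]) (use i j in \<open>auto simp: grand_children_def in_set_concat_nth simp del: set_concat\<close>)
        moreover have "kids v' ! j ! i \<in> subtrees T'"
          by (rule grand_child_in_subtrees[OF ENode.prems(2)]) (use i' j in \<open>auto simp: grand_children_def in_set_concat_nth simp del: set_concat\<close>)
        moreover have "lab (cs ! j ! i) = lab (kids v' ! j ! i)" using m i i' by (metis nth_map)
        ultimately show "cs ! j ! i = kids v' ! j ! i"
          using ENode.IH[OF nth_mem nth_mem] j i by blast
      qed
    qed
    ultimately have "cs = kids v'" by (simp add: nth_equalityI)
    then show ?case using ENode.prems(3) by (cases v') auto
  qed
  then show ?thesis using assms(5) by simp
qed

section \<open>Pruned even trees described locally\<close>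

fun unprune :: "nat \<Rightarrow> etree \<Rightarrow> etree" where
  "unprune k (ENode x cs) = ENode x (if cs = [] then replicate k [] else map (map (unprune k)) cs)"

text \<open>Pruning deletes children exactly where all of them are leaves, so surviving children
  always come with a grandchild. Conversely \<open>unprune k T\<close>, which hangs \<open>k\<close>
  leaves below every childless node, is an even \<open>k\<close>-ary preimage of
  \<open>T\<close>.\<close>

lemma pruned_even_kary_iff:
  "T \<in> pruned_even_kary k \<longleftrightarrow>
     (\<forall>v\<in>subtrees T. kids v = [] \<or> length (kids v) = k \<and> grand_children v \<noteq> [])"
proof
  assume "T \<in> pruned_even_kary k"
  then obtain U where U: "even_kary k U" "T = prune U" unfolding pruned_even_kary_def by blast
  have "\<forall>v\<in>subtrees (prune U). kids v = [] \<or> length (kids v) = k \<and> grand_children v \<noteq> []"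
    using U(1)
  proof (induction U)
    case (ENode x cs)
    have "even_kary k t" if "c \<in> set cs" "t \<in> set c" for c t
      using ENode.prems that unfolding even_kary_def by auto
    moreover have "length cs = k" using ENode.prems unfolding even_kary_def by auto
    ultimately show ?case using ENode.IH by (auto simp: grand_children_def)
  qed
  with U(2) show "\<forall>v\<in>subtrees T. kids v = [] \<or> length (kids v) = k \<and> grand_children v \<noteq> []" by simp
next
  assume "\<forall>v\<in>subtrees T. kids v = [] \<or> length (kids v) = k \<and> grand_children v \<noteq> []"
  then have "prune (unprune k T) = T \<and> even_kary k (unprune k T)"
  proof (induction T)
    case (ENode x cs)
    have "prune (unprune k t) = t \<and> even_kary k (unprune k t)" if "c \<in> set cs" "t \<in> set c" for c t
      using ENode that by auto
    then have "map (map (prune \<circ> unprune k)) cs = cs" "\<forall>c\<in>set cs. \<forall>t\<in>set c. even_kary k (unprune k t)"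
      by (auto simp: map_idI)
    moreover have "cs = [] \<or> length cs = k \<and> concat cs \<noteq> []"
      using ENode.prems by (auto simp: grand_children_def)
    ultimately show ?case by (auto simp: even_kary_def)
  qed
  then show "T \<in> pruned_even_kary k" unfolding pruned_even_kary_def by (metis image_eqI mem_Collect_eq)
qed

definition valid :: "nat \<Rightarrow> etree \<Rightarrow> bool" where
  "valid k T \<longleftrightarrow> regular k T \<and> distinct (labels T)"

lemma inc_trees_iff: "T \<in> inc_trees k (set (labels T)) \<longleftrightarrow> valid k T \<and> 0 \<notin> set (labels T)"
  unfolding inc_trees_def valid_def regular_def pruned_even_kary_iff by blast

section \<open>Old internal nodes and young leaves read off from edges\<close>

definition old_int :: "(nat \<times> nat \<times> nat) set \<Rightarrow> nat set" where
  "old_int R = {x. \<exists>p i. (p, i, x) \<in> R \<and> (\<forall>j w. (p, j, w) \<in> R \<longrightarrow> w \<le> x) \<and> (\<exists>j w. (x, j, w) \<in> R)}"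

definition young_leaf :: "(nat \<times> nat \<times> nat) set \<Rightarrow> nat set" where
  "young_leaf R = {x. \<exists>p i. (p, i, x) \<in> R \<and> (\<exists>j w. (p, j, w) \<in> R \<and> x < w) \<and> (\<forall>j w. (x, j, w) \<notin> R)}"

lemma grand_child_edge:
  assumes "valid k T" "u \<in> subtrees T"
  shows "v \<in> set (grand_children u) \<longleftrightarrow> v \<in> subtrees T \<and> (\<exists>i. (lab u, i, lab v) \<in> edges T)"
proof -
  have D: "distinct (labels T)" using assms unfolding valid_def by blast
  note I = inj_onD[OF inj_on_lab_subtrees[OF D]]
  have "w \<in> subtrees T" if "i < length (kids u)" "w \<in> set (kids u ! i)" for i w
    using grand_child_in_subtrees[OF assms(2)] that
      unfolding grand_children_def in_set_concat_nth by blast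
  then show ?thesis
    using I unfolding grand_children_def in_set_concat_nth out_edges[OF D assms(2)] by blast
qed

lemma edges_subtrees:
  assumes "(u, i, w) \<in> edges T"
  shows "\<exists>v\<in>subtrees T. \<exists>v'\<in>subtrees T. lab v = u \<and> lab v' = w"
  using assms set_labels[of T] edge_source[OF assms] edge_target[OF assms] by (metis imageE)

lemma leaf_iff:
  assumes "valid k T" "v \<in> subtrees T"
  shows "leaf v \<longleftrightarrow> (\<forall>j w. (lab v, j, w) \<notin> edges T)"
  using kids_nonempty_iff assms unfolding valid_def leaf_def by blast

lemma Oint_tree_edges:
  assumes "valid k T" shows "Oint_tree T = old_int (edges T)"
proof (intro equalityI subsetI)
  fix x assume "x \<in> Oint_tree T"
  then obtain u v where *: "x = lab v" "internal v" "u \<in> subtrees T" "v \<in> set (grand_children u)"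
    "\<forall>w\<in>set (grand_children u). lab w \<le> lab v"
    unfolding Oint_tree_def old_def is_grand_parent_def by blast
  then have v: "v \<in> subtrees T" "\<exists>i. (lab u, i, lab v) \<in> edges T"
    using grand_child_edge[OF assms] by blast+
  have "w \<le> x" if "(lab u, j, w) \<in> edges T" for j w
    using edges_subtrees[OF that] grand_child_edge[OF assms *(3)] that * by blast
  then show "x \<in> old_int (edges T)"
    using * v leaf_iff[OF assms v(1)] unfolding old_int_def internal_def by blast
next
  fix x assume "x \<in> old_int (edges T)"
  then obtain p i where *: "(p, i, x) \<in> edges T" "\<forall>j w. (p, j, w) \<in> edges T \<longrightarrow> w \<le> x" "\<exists>j w. (x, j, w) \<in> edges T"
    unfolding old_int_def by blast
  obtain u v where uv: "u \<in> subtrees T" "v \<in> subtrees T" "lab u = p" "lab v = x"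
    using edges_subtrees[OF *(1)] by blast
  then show "x \<in> Oint_tree T"
    using * grand_child_edge[OF assms uv(1)] leaf_iff[OF assms uv(2)]
    unfolding Oint_tree_def old_def is_grand_parent_def internal_def by blast
qed

lemma Yleaf_tree_edges:
  assumes "valid k T" shows "Yleaf_tree T = young_leaf (edges T)"
proof (intro equalityI subsetI)
  fix x assume "x \<in> Yleaf_tree T"
  then obtain u v t where *: "x = lab v" "leaf v" "u \<in> subtrees T" "v \<in> set (grand_children u)"
    "t \<in> set (grand_children u)" "\<not> lab t \<le> lab v"
    unfolding Yleaf_tree_def young_def is_grand_parent_def by blast
  then have v: "v \<in> subtrees T" "\<exists>i. (lab u, i, lab v) \<in> edges T" "\<exists>i. (lab u, i, lab t) \<in> edges T"
    using grand_child_edge[OF assms] by blast+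
  then show "x \<in> young_leaf (edges T)"
    using *(1,2,6) leaf_iff[OF assms v(1)] unfolding young_leaf_def not_le by blast
next
  fix x assume "x \<in> young_leaf (edges T)"
  then obtain p i j w where *: "(p, i, x) \<in> edges T" "(p, j, w) \<in> edges T" "\<not> w \<le> x" "\<forall>j w. (x, j, w) \<notin> edges T"
    unfolding young_leaf_def not_le by blast
  obtain u v where uv: "u \<in> subtrees T" "v \<in> subtrees T" "lab u = p" "lab v = x"
    using edges_subtrees[OF *(1)] by blast
  obtain t where t: "t \<in> subtrees T" "lab t = w" using edges_subtrees[OF *(2)] by blast
  have "leaf v" using leaf_iff[OF assms uv(2)] *(4) uv(4) by blast
  moreover have "v \<in> set (grand_children u)" "t \<in> set (grand_children u)"
    using * uv t grand_child_edge[OF assms uv(1)] by blast+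
  ultimately show "x \<in> Yleaf_tree T"
    using uv t *(3) unfolding Yleaf_tree_def young_def is_grand_parent_def by blast
qed

section \<open>Source changes, and their transport from a subtree to the whole tree\<close>

definition up_edge :: "nat \<Rightarrow> nat \<Rightarrow> nat \<times> nat \<times> nat \<Rightarrow> nat \<times> nat \<times> nat" where
  "up_edge p x = (\<lambda>(u, j, w). (if u = x then p else u, j, w))"

definition down_edge :: "nat \<Rightarrow> nat \<Rightarrow> nat \<times> nat \<times> nat \<Rightarrow> nat \<times> nat \<times> nat" where
  "down_edge p x = (\<lambda>(u, j, w). (if u = p \<and> x < w then x else u, j, w))"

lemma up_edge_image_iff:
  "(u, j, w) \<in> up_edge p x ` R \<longleftrightarrow> u \<noteq> x \<and> (u, j, w) \<in> R \<or> u = p \<and> (x, j, w) \<in> R"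
  by (simp add: up_edge_def image_iff Bex_def split_paired_Ex) metis

lemma down_edge_image_iff:
  "(u, j, w) \<in> down_edge p x ` R \<longleftrightarrow>
     (u, j, w) \<in> R \<and> \<not> (u = p \<and> x < w) \<or> u = x \<and> (p, j, w) \<in> R \<and> x < w"
  by (simp add: down_edge_def image_iff Bex_def split_paired_Ex) metis

lemma at_grand_parent_id: "x \<notin> set (labels T) \<Longrightarrow> at_grand_parent x f T = T"
proof (induction T)
  case (ENode a cs)
  have "x \<notin> lab ` set (grand_children (ENode a cs))"
    using ENode.prems lab_in_labels by (fastforce simp: grand_children_def)
  moreover have "map (map (at_grand_parent x f)) cs = cs"
    using ENode by (auto simp: map_idI)
  ultimately show ?case by simp
qed

text \<open>The recursion stops at the node labeled \<open>p\<close>, the unique source of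
  \<open>x\<close>. Since \<open>\<phi>\<close> moves only edges whose source is \<open>p\<close> or
  \<open>x\<close>, a description of \<open>f\<close> at that node extends to the whole tree.
  Keeping \<open>f\<close> and \<open>\<phi>\<close> abstract serves both \<open>lift_up\<close> and
  \<open>push_down\<close>.\<close>

lemma at_grand_parent_edges:
  assumes "regular k T" "distinct (labels T)" "(p, i, x) \<in> edges T"
    and "\<And>U. U \<in> subtrees T \<Longrightarrow> lab U = p \<Longrightarrow> regular k (f U) \<and> lab (f U) = p \<and> edges (f U) = \<phi> ` edges U"
    and "\<And>u j w. u \<noteq> p \<Longrightarrow> u \<noteq> x \<Longrightarrow> \<phi> (u, j, w) = (u, j, w)"
  shows "regular k (at_grand_parent x f T) \<and> lab (at_grand_parent x f T) = lab T \<and>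
         edges (at_grand_parent x f T) = \<phi> ` edges T"
  using assms(1-4)
proof (induction T)
  case (ENode a cs)
  let ?T = "ENode a cs"
  note D = distinct_labels_ENode[OF ENode.prems(2)]
  note fn = functional_edges[OF ENode.prems(2), unfolded functional_def]
  show ?case
  proof (cases "x \<in> lab ` set (grand_children ?T)")
    case True
    then obtain t where t: "t \<in> set (concat cs)" "x = lab t" unfolding grand_children_def by auto
    from t(1) obtain j where "j < length cs" "t \<in> set (cs ! j)" unfolding in_set_concat_nth by blast
    then have "(a, j, x) \<in> edges ?T" using t(2) unfolding edges_ENode by blast
    then have "a = p" using fn ENode.prems(3) by blast
    then show ?thesis using True ENode.prems(4)[of ?T] by simp
  next
    case False
    let ?g = "at_grand_parent x f"
    \<comment> \<open>\<open>t0\<close> is the branch containing the edge into \<open>x\<close>.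
      Both \<open>p\<close> and \<open>x\<close> occur there, so the root and all other branches
      avoid these labels and are fixed.\<close>
    obtain t0 where t0: "t0 \<in> set (concat cs)" "(p, i, x) \<in> edges t0"
    proof -
      have "x \<notin> lab ` set (cs ! j)" if "j < length cs" for j
        using False that in_set_concat_nth[of _ cs] unfolding grand_children_def etree.sel by blast
      then show ?thesis using ENode.prems(3) that unfolding edges_ENode by blast
    qed
    have ax: "a \<noteq> p" "a \<noteq> x" using D(1)[OF t0(1)] edge_source[OF t0(2)] edge_target[OF t0(2)] by auto
    have g: "regular k (?g t) \<and> lab (?g t) = lab t \<and> edges (?g t) = \<phi> ` edges t" if t: "t \<in> set (concat cs)" for t
    proof (cases "t = t0")
      case True
      show ?thesis
      proof -
        obtain c where "c \<in> set cs" "t \<in> set c" using t by auto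
        moreover have "regular k t" using ENode.prems(1) t unfolding regular_ENode by auto
        moreover have "regular k (f U) \<and> lab (f U) = p \<and> edges (f U) = \<phi> ` edges U"
          if "U \<in> subtrees t" "lab U = p" for U
          using ENode.prems(4)[of U] that t by auto
        ultimately show ?thesis using ENode.IH D(2) t t0(2) True by blast
      qed
    next
      case False
      then have px: "p \<notin> set (labels t)" "x \<notin> set (labels t)"
        using D(3)[OF t t0(1)] edge_source[OF t0(2)] edge_target[OF t0(2)] by auto
      moreover have "regular k t" using ENode.prems(1) t unfolding regular_ENode by auto
      moreover have "\<phi> ` edges t = edges t"
      proof -
        have "\<phi> e = e" if "e \<in> edges t" for e
        proof (cases e)
          case (fields u j w)
          then show ?thesis using assms(5) that edge_source[of u j w t] px by metis
        qed
        then show ?thesis by simp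
      qed
      ultimately show ?thesis using at_grand_parent_id px by simp
    qed
    have eq: "?g ?T = ENode a (map (map ?g) cs)" using False by simp
    have labs: "map lab (map ?g c) = map lab c" if "c \<in> set cs" for c
      using g that by auto
    have "concat (map (map ?g) cs) = map ?g (concat cs)" by (simp add: map_concat)
    then have cc: "set (concat (map (map ?g) cs)) = ?g ` set (concat cs)" by (metis set_map)
    have "regular k (?g ?T)"
    proof -
      have "concat (map (map ?g) cs) = [] \<longleftrightarrow> concat cs = []" using cc by (metis image_is_empty set_empty)
      moreover have "sorted_wrt (<) (map lab (map ?g c))" if "c \<in> set cs" for c
        using ENode.prems(1) labs[OF that] that unfolding regular_ENode by metis
      moreover have "a < lab (?g t) \<and> regular k (?g t)" if "c \<in> set cs" "t \<in> set c" for c t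
      proof -
        have "t \<in> set (concat cs)" using that by auto
        with g ENode.prems(1) that show ?thesis unfolding regular_ENode by metis
      qed
      ultimately show ?thesis
        using ENode.prems(1) unfolding eq regular_ENode
          by (simp del: map_map set_concat concat_eq_Nil_conv)
    qed
    moreover have "edges (?g ?T) = \<phi> ` edges ?T"
    proof -
      have "edges (?g ?T) = {(u, j, w). u = a \<and> j < length cs \<and> w \<in> lab ` set (cs ! j)} \<union> (\<Union>t\<in>set (concat cs). edges (?g t))"
      proof -
        have "(u, j, w) \<in> edges (?g ?T) \<longleftrightarrow>
          u = a \<and> j < length cs \<and> w \<in> lab ` set (cs ! j) \<or> (\<exists>t\<in>set (concat cs). (u, j, w) \<in> edges (?g t))" for u j w
        proof -
          have "lab ` set (map (map ?g) cs ! j) = lab ` set (cs ! j)" if "j < length cs"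
            using labs[of "cs ! j"] that by (metis nth_map nth_mem set_map)
          then show ?thesis unfolding eq edges_ENode cc length_map by blast
        qed
        then show ?thesis by auto
      qed
      also have "{(u, j, w). u = a \<and> j < length cs \<and> w \<in> lab ` set (cs ! j)} =
          \<phi> ` {(u, j, w). u = a \<and> j < length cs \<and> w \<in> lab ` set (cs ! j)}"
      proof -
        have "\<phi> e = e" if "e \<in> {(u, j, w). u = a \<and> j < length cs \<and> w \<in> lab ` set (cs ! j)}" for e
          using that assms(5)[OF ax] by auto
        then show ?thesis by simp
      qed
      also have "(\<Union>t\<in>set (concat cs). edges (?g t)) = \<phi> ` (\<Union>t\<in>set (concat cs). edges t)"
        using g by (simp add: image_UN del: set_concat)
      also have "\<phi> ` {(u, j, w). u = a \<and> j < length cs \<and> w \<in> lab ` set (cs ! j)} \<union> \<phi> ` (\<Union>t\<in>set (concat cs). edges t)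
          = \<phi> ` edges ?T"
      proof -
        have "edges ?T = {(u, j, w). u = a \<and> j < length cs \<and> w \<in> lab ` set (cs ! j)} \<union> (\<Union>t\<in>set (concat cs). edges t)"
          by (auto simp: edges_ENode)
        then show ?thesis by (simp only: image_Un)
      qed
      finally show ?thesis .
    qed
    moreover have "lab (?g ?T) = a" unfolding eq by simp
    ultimately show ?thesis by simp
  qed
qed

section \<open>The action on edges\<close>

lemma strict_sorted_sort_key:
  "distinct (map lab ts) \<Longrightarrow> sorted_wrt (<) (map lab (sort_key lab ts))"
  by (simp add: strict_sorted_iff distinct_map)

lemma grand_child_unique:
  assumes "distinct (labels (ENode p cs))" "v \<in> set (concat cs)" "t \<in> set (concat cs)"
    "lab v \<in> set (labels t)"
  shows "t = v"
  using distinct_labels_ENode(3)[OF assms(1) assms(2,3)] assms(4) lab_in_labels by blast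

text \<open>Maximality of \<open>x\<close> among the grandchildren makes the merged lists
  collision-free, since all labels below \<open>v\<close> exceed \<open>x\<close>. The node
  \<open>v\<close> itself stays in place as a leaf, so only the edges leaving \<open>x\<close>
  change.\<close>

lemma lift_up_edges:
  assumes reg: "regular k (ENode p cs)" and dist: "distinct (labels (ENode p cs))"
    and v: "v \<in> set (concat cs)" "lab v = x" "kids v \<noteq> []"
    and max: "\<And>t. t \<in> set (concat cs) \<Longrightarrow> lab t \<le> x"
  shows "regular k (lift_up x (ENode p cs)) \<and> lab (lift_up x (ENode p cs)) = p \<and>
         edges (lift_up x (ENode p cs)) = up_edge p x ` edges (ENode p cs)"
proof -
  obtain ds where vd: "v = ENode x ds" using v(2) by (cases v) auto
  have regv: "regular k (ENode x ds)" and px: "p < x"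
    using reg v(1,2) vd unfolding regular_ENode[of k p] by (auto; fastforce)+
  have uniq: "t = v" if "t \<in> set (concat cs)" "lab t = x" for t
    using grand_child_unique[OF dist v(1) that(1)] that(2) v(2) lab_in_labels[of t] by simp
  \<comment> \<open>The label \<open>x\<close> occurs only once among the grandchildren, so taking
    the first match really selects \<open>v\<close>.\<close>
  have hd: "hd (filter (\<lambda>t. lab t = x) (concat cs)) = v"
  proof -
    have "filter (\<lambda>t. lab t = x) (concat cs) \<noteq> []" using v by (metis (mono_tags) filter_empty_conv)
    then have "hd (filter (\<lambda>t. lab t = x) (concat cs)) \<in> set (filter (\<lambda>t. lab t = x) (concat cs))"
      by (rule hd_in_set)
    then show ?thesis using uniq by (simp del: set_concat)
  qed
  define repl where "repl = (\<lambda>t. if lab t = x then ENode x [] else t)"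
  define cs' where "cs' = map2 (\<lambda>\<mu> \<nu>. sort_key lab (map repl \<mu> @ \<nu>)) cs ds"
  have lift: "lift_up x (ENode p cs) = ENode p cs'"
    unfolding lift_up_def grand_children_def cs'_def repl_def using hd vd by simp
  have len: "length cs = k" "length ds = k" "concat cs \<noteq> []"
    using reg regv v vd unfolding regular_ENode by auto
  have len': "length cs' = k" unfolding cs'_def using len by simp
  have cs'_nth: "cs' ! j = sort_key lab (map repl (cs ! j) @ ds ! j)" if "j < k" for j
    unfolding cs'_def using len that by simp
  have lab_repl [simp]: "lab (repl t) = lab t" for t unfolding repl_def by simp
  have set': "set (cs' ! j) = repl ` set (cs ! j) \<union> set (ds ! j)" if "j < k" for j
    using cs'_nth[OF that] by simp
  have concat': "set (concat cs') = repl ` set (concat cs) \<union> set (concat ds)"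
    using set' len by (simp add: set_concat_nth len' image_UN UN_Un_distrib del: set_concat)
  have ds_gt: "x < lab s" "regular k s" if "s \<in> set (concat ds)" for s
    using regv that unfolding regular_ENode by auto
  have cs_gt: "p < lab t" "regular k t" if "t \<in> set (concat cs)" for t
    using reg that unfolding regular_ENode by auto
  have "regular k (ENode p cs')"
    unfolding regular_ENode
  proof (intro conjI ballI)
    have "concat cs' \<noteq> []" using concat' len(3) by (metis Un_empty image_is_empty set_empty)
    then show "cs' = [] \<or> length cs' = k \<and> concat cs' \<noteq> []" using len' by blast
  next
    fix c assume "c \<in> set cs'"
    then obtain j where j: "j < k" "c = cs' ! j" using len' by (auto simp: in_set_conv_nth)
    have mem: "cs ! j \<in> set cs" "ds ! j \<in> set ds" using j len by auto
    have "distinct (map lab (cs ! j))" "distinct (map lab (ds ! j))"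
      using reg regv mem unfolding regular_ENode by (auto simp: strict_sorted_iff)
    \<comment> \<open>Old labels are at most \<open>x\<close>, arriving ones are greater; hence
      sorting gives a strictly increasing list.\<close>
    moreover have "lab ` set (cs ! j) \<inter> lab ` set (ds ! j) = {}"
    proof -
      have "lab s \<noteq> lab t" if "t \<in> set (cs ! j)" "s \<in> set (ds ! j)" for s t
        using max[of t] ds_gt(1)[of s] that mem by force
      then show ?thesis by force
    qed
    ultimately have "distinct (map lab (map repl (cs ! j) @ ds ! j))" by (simp add: o_def)
    then show "sorted_wrt (<) (map lab c)" unfolding j cs'_nth[OF j(1)] by (rule strict_sorted_sort_key)
  next
    fix c t assume "c \<in> set cs'" "t \<in> set c"
    then have "t \<in> set (concat cs')" by auto
    then have "t \<in> repl ` set (concat cs) \<or> t \<in> set (concat ds)" unfolding concat' by blast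
    moreover have "regular k (ENode x [])" unfolding regular_ENode by simp
    ultimately have "p < lab t \<and> regular k t" using cs_gt ds_gt(2) less_trans[OF px ds_gt(1)] px
      by (auto simp: repl_def simp del: set_concat)
    then show "p < lab t" "regular k t" by auto
  qed
  moreover have "edges (ENode p cs') = up_edge p x ` edges (ENode p cs)"
  proof -
    have *: "(u, j, w) \<in> edges (ENode p cs') \<longleftrightarrow> (u, j, w) \<in> up_edge p x ` edges (ENode p cs)" for u j w
    proof -
      have E0: "(\<exists>t\<in>set (concat cs'). (u, j, w) \<in> edges t) \<longleftrightarrow>
          (\<exists>t\<in>set (concat cs). t \<noteq> v \<and> (u, j, w) \<in> edges t) \<or> (\<exists>s\<in>set (concat ds). (u, j, w) \<in> edges s)"
      proof -
        have "(u, j, w) \<in> edges (repl t) \<longleftrightarrow> t \<noteq> v \<and> (u, j, w) \<in> edges t" if "t \<in> set (concat cs)" for t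
          using uniq[OF that] v(2) by (auto simp: repl_def edges_ENode)
        then show ?thesis unfolding concat' by blast
      qed
      \<comment> \<open>The edges before the move, split into those from the root, in branches other
        than \<open>v\<close>, from \<open>v\<close>, and below \<open>v\<close>.\<close>
      have E1: "(u, j, w) \<in> edges (ENode p cs) \<longleftrightarrow> u = p \<and> j < k \<and> w \<in> lab ` set (cs ! j) \<or>
          (\<exists>t\<in>set (concat cs). t \<noteq> v \<and> (u, j, w) \<in> edges t) \<or>
          u = x \<and> j < k \<and> w \<in> lab ` set (ds ! j) \<or> (\<exists>s\<in>set (concat ds). (u, j, w) \<in> edges s)" for u
      proof -
        have "(u, j, w) \<in> edges v \<longleftrightarrow> u = x \<and> j < k \<and> w \<in> lab ` set (ds ! j) \<or> (\<exists>s\<in>set (concat ds). (u, j, w) \<in> edges s)"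
          unfolding vd edges_ENode len ..
        moreover have "(\<exists>t\<in>set (concat cs). (u, j, w) \<in> edges t) \<longleftrightarrow>
            (\<exists>t\<in>set (concat cs). t \<noteq> v \<and> (u, j, w) \<in> edges t) \<or> (u, j, w) \<in> edges v"
          using v(1) by metis
        ultimately show ?thesis unfolding edges_ENode[of _ _ _ p] len by simp
      qed
      \<comment> \<open>Edges with source \<open>x\<close> start at \<open>v\<close> only: other
        branches do not contain \<open>x\<close>, and the labels strictly below \<open>v\<close> are
        larger.\<close>
      have n1: "(x, j, w) \<notin> edges t" if "t \<in> set (concat cs)" "t \<noteq> v" for t
        using grand_child_unique[OF dist v(1) that(1)] that(2) edge_source v(2) by blast
      have n2: "(x, j, w) \<notin> edges s" if "s \<in> set (concat ds)" for s
        using ds_gt[OF that] lab_le_labels[of k s x] edge_source[of x j w s] by auto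
      have E2: "(x, j, w) \<in> edges (ENode p cs) \<longleftrightarrow> j < k \<and> w \<in> lab ` set (ds ! j)"
        unfolding E1 using n1 n2 px by blast
      have E3: "j < k \<Longrightarrow> w \<in> lab ` set (cs' ! j) \<longleftrightarrow> w \<in> lab ` set (cs ! j) \<or> w \<in> lab ` set (ds ! j)"
        using set' by (auto simp: image_Un image_image)
      have "u = x \<Longrightarrow> \<not> (\<exists>t\<in>set (concat cs). t \<noteq> v \<and> (u, j, w) \<in> edges t)"
        "u = x \<Longrightarrow> \<not> (\<exists>s\<in>set (concat ds). (u, j, w) \<in> edges s)" "p \<noteq> x"
        using n1 n2 px by blast+
      then show ?thesis
        unfolding edges_ENode[of _ _ _ p cs'] len' up_edge_image_iff E2 E0 E1[of u] using E3 by argo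
    qed
    then show ?thesis by auto
  qed
  ultimately show ?thesis unfolding lift by simp
qed

text \<open>The larger sibling \<open>t0\<close> gives the new children of \<open>v\<close> at least
  one subtree, while \<open>v\<close> itself remains below \<open>p\<close>. Thus neither node ends
  up with children that are all leaves, and the result is still a pruned tree.\<close>

lemma push_down_edges:
  assumes reg: "regular k (ENode p cs)" and dist: "distinct (labels (ENode p cs))"
    and v: "v \<in> set (concat cs)" "lab v = x" "kids v = []"
    and young: "t0 \<in> set (concat cs)" "x < lab t0"
  shows "regular k (push_down x (ENode p cs)) \<and> lab (push_down x (ENode p cs)) = p \<and>
         edges (push_down x (ENode p cs)) = down_edge p x ` edges (ENode p cs)"
proof -
  have vd: "v = ENode x []" using v(2,3) by (cases v) auto
  have px: "p < x" using reg v unfolding regular_ENode[of k p] by auto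
  have uniq: "t = v" if "t \<in> set (concat cs)" "lab t = x" for t
    using grand_child_unique[OF dist v(1) that(1)] that(2) v(2) lab_in_labels[of t] by simp
  define ds where "ds = map (\<lambda>\<mu>. sort_key lab (filter (\<lambda>t. x < lab t) \<mu>)) cs"
  define repl where "repl = (\<lambda>t. if lab t = x then ENode x ds else t)"
  define cs' where "cs' = map (\<lambda>\<mu>. map repl (filter (\<lambda>t. \<not> x < lab t) \<mu>)) cs"
  have push: "push_down x (ENode p cs) = ENode p cs'"
    unfolding push_down_def cs'_def repl_def ds_def by simp
  have len: "length cs = k" using reg v unfolding regular_ENode by auto
  have len': "length cs' = k" "length ds = k" unfolding cs'_def ds_def using len by simp_all
  have lab_repl [simp]: "lab (repl t) = lab t" for t unfolding repl_def by simp
  have set': "set (cs' ! j) = repl ` {t \<in> set (cs ! j). lab t \<le> x}" "set (ds ! j) = {t \<in> set (cs ! j). x < lab t}"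
    if "j < k" for j
    using that len unfolding cs'_def ds_def by (auto simp: not_less)
  have concat': "set (concat cs') = repl ` {t \<in> set (concat cs). lab t \<le> x}"
  proof -
    have "{t \<in> \<Union>j<k. set (cs ! j). lab t \<le> x} = (\<Union>j<k. {t \<in> set (cs ! j). lab t \<le> x})" by blast
    then show ?thesis using set'(1) by (simp add: set_concat_nth len len' image_UN del: set_concat)
  qed
  have concat_ds: "set (concat ds) = {t \<in> set (concat cs). x < lab t}"
  proof -
    have "t \<in> set (concat ds) \<longleftrightarrow> t \<in> {t \<in> set (concat cs). x < lab t}" for t
      unfolding in_set_concat_nth mem_Collect_eq len len' using set'(2) by auto
    then show ?thesis by blast
  qed
  have cs_gt: "p < lab t" "regular k t" if "t \<in> set (concat cs)" for t
    using reg that unfolding regular_ENode by auto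
  have strict: "sorted_wrt (<) (map lab (cs ! j))" if "j < k" for j
    using reg that len unfolding regular_ENode by auto
  have reg_v': "regular k (ENode x ds)"
    unfolding regular_ENode
  proof (intro conjI ballI)
    have "concat ds \<noteq> []"
      using concat_ds young by (metis (mono_tags, lifting) empty_iff mem_Collect_eq set_empty)
    then show "ds = [] \<or> length ds = k \<and> concat ds \<noteq> []" using len' by blast
  next
    fix c assume "c \<in> set ds"
    then obtain j where j: "j < k" "c = ds ! j" using len' by (auto simp: in_set_conv_nth)
    then have c: "c = sort_key lab (filter (\<lambda>t. x < lab t) (cs ! j))" unfolding ds_def using len by simp
    have "distinct (map lab (cs ! j))" using strict[OF j(1)] by (simp add: strict_sorted_iff)
    then show "sorted_wrt (<) (map lab c)" unfolding c
      by (intro strict_sorted_sort_key) (simp add: distinct_map_filter)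
  next
    fix c t assume "c \<in> set ds" "t \<in> set c"
    then have "t \<in> set (concat ds)" by auto
    then show "x < lab t" "regular k t" using cs_gt unfolding concat_ds by auto
  qed
  have "regular k (ENode p cs')"
    unfolding regular_ENode
  proof (intro conjI ballI)
    have "repl v \<in> set (concat cs')" using v unfolding concat' by blast
    then have "concat cs' \<noteq> []" by (metis empty_iff set_empty)
    then show "cs' = [] \<or> length cs' = k \<and> concat cs' \<noteq> []" using len' by blast
  next
    fix c assume "c \<in> set cs'"
    then obtain j where j: "j < k" "c = cs' ! j" using len' by (auto simp: in_set_conv_nth)
    then have c: "c = map repl (filter (\<lambda>t. \<not> x < lab t) (cs ! j))" unfolding cs'_def using len by simp
    have "map lab c = map lab (filter (\<lambda>t. \<not> x < lab t) (cs ! j))" unfolding c by (simp add: o_def)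
    then show "sorted_wrt (<) (map lab c)"
      using strict[OF j(1)] by (simp add: sorted_wrt_map sorted_wrt_filter)
  next
    fix c t assume "c \<in> set cs'" "t \<in> set c"
    then have "t \<in> set (concat cs')" by auto
    then have "p < lab t \<and> regular k t"
      using cs_gt reg_v' px unfolding concat' by (auto simp: repl_def simp del: set_concat)
    then show "p < lab t" "regular k t" by auto
  qed
  moreover have "edges (ENode p cs') = down_edge p x ` edges (ENode p cs)"
  proof -
    have *: "(u, j, w) \<in> edges (ENode p cs') \<longleftrightarrow> (u, j, w) \<in> down_edge p x ` edges (ENode p cs)" for u j w
    proof -
      have E0: "(\<exists>t\<in>set (concat cs'). (u, j, w) \<in> edges t) \<longleftrightarrow>
          (\<exists>t\<in>set (concat cs). lab t < x \<and> (u, j, w) \<in> edges t) \<or> (u, j, w) \<in> edges (ENode x ds)"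
      proof -
        \<comment> \<open>The retained grandchildren are those of smaller label, unchanged, and
          \<open>v\<close>, now carrying the new children \<open>ds\<close>.\<close>
        have "repl ` {t \<in> set (concat cs). lab t \<le> x} = insert (ENode x ds) {t \<in> set (concat cs). lab t < x}"
        proof -
          have "{t \<in> set (concat cs). lab t \<le> x} = insert v {t \<in> set (concat cs). lab t < x}"
          proof (rule set_eqI)
            fix t
            show "t \<in> {t \<in> set (concat cs). lab t \<le> x} \<longleftrightarrow> t \<in> insert v {t \<in> set (concat cs). lab t < x}"
              unfolding mem_Collect_eq insert_iff using uniq[of t] v(1,2) by (metis le_less)
          qed
          moreover have "repl v = ENode x ds" "\<And>t. lab t < x \<Longrightarrow> repl t = t"
            using v(2) by (simp_all add: repl_def)
          ultimately show ?thesis by (auto simp del: set_concat)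
        qed
        then have "set (concat cs') = insert (ENode x ds) {t \<in> set (concat cs). lab t < x}"
          unfolding concat' .
        moreover have "(\<exists>t\<in>insert a {t \<in> C. Q t}. P t) \<longleftrightarrow> (\<exists>t\<in>C. Q t \<and> P t) \<or> P a" for a C Q
          and P :: "etree \<Rightarrow> bool"
          by blast
        ultimately show ?thesis by presburger
      qed
      have E1: "(u, j, w) \<in> edges (ENode x ds) \<longleftrightarrow>
          u = x \<and> j < k \<and> w \<in> lab ` set (cs ! j) \<and> x < w \<or> (\<exists>t\<in>set (concat cs). x < lab t \<and> (u, j, w) \<in> edges t)"
      proof -
        have "j < k \<Longrightarrow> w \<in> lab ` set (ds ! j) \<longleftrightarrow> w \<in> lab ` set (cs ! j) \<and> x < w"
          using set'(2) by auto
        then show ?thesis unfolding edges_ENode len' concat_ds by blast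
      qed
      have n1: "(p, j, w) \<notin> edges t" if "t \<in> set (concat cs)" for t
        using distinct_labels_ENode(1)[OF dist that] edge_source by blast
      have E2: "(p, j, w) \<in> edges (ENode p cs) \<longleftrightarrow> j < k \<and> w \<in> lab ` set (cs ! j)"
        unfolding edges_ENode len using n1 by blast
      have E3: "j < k \<Longrightarrow> w \<in> lab ` set (cs' ! j) \<longleftrightarrow> w \<in> lab ` set (cs ! j) \<and> \<not> x < w"
        using set'(1) by (auto simp: image_image not_less)
      \<comment> \<open>The only grandchild labeled \<open>x\<close> is the leaf \<open>v\<close>,
        which contributes no edges, so the strict inequalities lose nothing.\<close>
      have E4: "(\<exists>t\<in>set (concat cs). (u, j, w) \<in> edges t) \<longleftrightarrow>
          (\<exists>t\<in>set (concat cs). lab t < x \<and> (u, j, w) \<in> edges t) \<or> (\<exists>t\<in>set (concat cs). x < lab t \<and> (u, j, w) \<in> edges t)"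
      proof -
        have "lab t < x \<or> x < lab t" if "t \<in> set (concat cs)" "(u, j, w) \<in> edges t" for t
          using uniq[OF that(1)] that(2) vd by (cases "lab t = x") (auto simp: edges_ENode)
        then show ?thesis by metis
      qed
      have nA: "u = p \<Longrightarrow> \<not> (\<exists>t\<in>set (concat cs). lab t < x \<and> (u, j, w) \<in> edges t)"
        "u = p \<Longrightarrow> \<not> (\<exists>t\<in>set (concat cs). x < lab t \<and> (u, j, w) \<in> edges t)"
        using n1 by blast+
      show ?thesis
        unfolding edges_ENode[of _ _ _ p cs'] len' down_edge_image_iff E2 E0 E1
        unfolding edges_ENode[of u j w p cs] len E4 not_less[symmetric] using E3 nA by argo
    qed
    then show ?thesis by auto
  qed
  ultimately show ?thesis unfolding push by simp
qed

section \<open>Lifting and pushing on abstract edge sets\<close>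

lemma up_down_edge:
  assumes "p < x" "\<And>j w. (x, j, w) \<notin> R"
  shows "up_edge p x ` down_edge p x ` R = R"
proof -
  have "(u, j, w) \<in> up_edge p x ` down_edge p x ` R \<longleftrightarrow> (u, j, w) \<in> R" for u j w
    unfolding up_edge_image_iff down_edge_image_iff using assms by auto
  then show ?thesis by (simp only: set_eq_iff split_paired_All simp_thms)
qed

text \<open>After the lift, the edges out of \<open>p\<close> remain separable by comparing targets
  with \<open>x\<close>: the original ones reach at most \<open>x\<close>, the lifted ones go beyond
  it. In \<open>up_down_edge\<close> the corresponding fact is that nothing left \<open>x\<close>
  before the push.\<close>

lemma down_up_edge:
  assumes "p < x" "\<And>j w. (p, j, w) \<in> R \<Longrightarrow> w \<le> x" "\<And>j w. (x, j, w) \<in> R \<Longrightarrow> x < w"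
  shows "down_edge p x ` up_edge p x ` R = R"
proof -
  have "(u, j, w) \<in> down_edge p x ` up_edge p x ` R \<longleftrightarrow> (u, j, w) \<in> R" for u j w
    unfolding up_edge_image_iff down_edge_image_iff 
    using assms(1) assms(2)[of j w] assms(3)[of j w] by (cases "u = x"; cases "u = p"; auto)
  then show ?thesis by (simp only: set_eq_iff split_paired_All simp_thms)
qed

text \<open>The conditionals follow the grand parent as it moves: if \<open>y\<close> is the grand
  parent of \<open>x\<close>, then lifting \<open>y\<close> makes \<open>q\<close> the grand parent
  of \<open>x\<close>, and symmetrically. The cases \<open>p = y\<close> and \<open>q = x\<close>
  cannot both occur, as \<open>p < x\<close> and \<open>q < y\<close>.\<close>

lemma up_edge_commute:
  assumes "p < x" "q < y" "x \<noteq> y"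
  shows "up_edge (if p = y then q else p) x ` up_edge q y ` R = up_edge (if q = x then p else q) y ` up_edge p x ` R"
  unfolding image_comp by (rule image_cong[OF refl]) (use assms in \<open>auto simp: up_edge_def\<close>)

text \<open>Only \<open>x\<close> loses its outgoing edges, and \<open>p\<close> already had one.
  Among the targets of \<open>p\<close> only \<open>x\<close> was old; if anything is lifted, the
  greatest target of \<open>x\<close> becomes the greatest target of \<open>p\<close>, because
  targets of \<open>x\<close> exceed \<open>x\<close>. So every other old internal label keeps its
  status and none is gained.\<close>

lemma old_int_up_edge:
  assumes less: "\<And>u j w. (u, j, w) \<in> R \<Longrightarrow> u < w"
    and x: "(p, i, x) \<in> R" "\<And>j w. (p, j, w) \<in> R \<Longrightarrow> w \<le> x"
  shows "old_int (up_edge p x ` R) = old_int R - {x}"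
proof (intro equalityI subsetI)
  have px: "p < x" using less x(1) .
  fix y assume "y \<in> old_int (up_edge p x ` R)"
  then obtain q l where y: "(q, l, y) \<in> up_edge p x ` R"
    "\<And>j w. (q, j, w) \<in> up_edge p x ` R \<Longrightarrow> w \<le> y" "\<exists>j w. (y, j, w) \<in> up_edge p x ` R"
    unfolding old_int_def by blast
  have yx: "y \<noteq> x" using y(3) px unfolding up_edge_image_iff by auto
  have out: "\<exists>j w. (y, j, w) \<in> R" using y(3) x(1) unfolding up_edge_image_iff by blast
  from y(1) consider "q \<noteq> x" "(q, l, y) \<in> R" | "q = p" "(x, l, y) \<in> R"
    unfolding up_edge_image_iff by blast
  then show "y \<in> old_int R - {x}"
  proof cases
    case 1
    then show ?thesis using y(2) out yx unfolding old_int_def up_edge_image_iff by blast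
  next
    case 2
    then show ?thesis using y(2) out yx unfolding old_int_def up_edge_image_iff by blast
  qed
next
  have px: "p < x" using less x(1) .
  fix y assume "y \<in> old_int R - {x}"
  then obtain q l where y: "(q, l, y) \<in> R" "\<And>j w. (q, j, w) \<in> R \<Longrightarrow> w \<le> y" "\<exists>j w. (y, j, w) \<in> R" "y \<noteq> x"
    unfolding old_int_def by blast
  have out: "\<exists>j w. (y, j, w) \<in> up_edge p x ` R" using y(3,4) unfolding up_edge_image_iff by blast
  show "y \<in> old_int (up_edge p x ` R)"
  proof (cases "q = x")
    case True
    then have "(p, l, y) \<in> up_edge p x ` R" using y(1) unfolding up_edge_image_iff by blast
    moreover have "w \<le> y" if "(p, j, w) \<in> up_edge p x ` R" for j w
    proof -
      from that have "(p, j, w) \<in> R \<or> (x, j, w) \<in> R" unfolding up_edge_image_iff by blast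
      then show ?thesis using y(2)[of j w] x(2)[of j w] less[OF y(1)] True by auto
    qed
    ultimately show ?thesis using out unfolding old_int_def by blast
  next
    case False
    then have "(q, l, y) \<in> up_edge p x ` R" using y(1) unfolding up_edge_image_iff by blast
    moreover have "q \<noteq> p" using x y(1,2,4) by (metis le_antisym)
    then have "w \<le> y" if "(q, j, w) \<in> up_edge p x ` R" for j w
      using that y(2) unfolding up_edge_image_iff by blast
    ultimately show ?thesis using out unfolding old_int_def by blast
  qed
qed

text \<open>The label \<open>x\<close> becomes a leaf and is young because \<open>w0\<close>, now
  its sibling, is greater. A leaf originally below \<open>p\<close> is less than \<open>x\<close>
  and so was young already; a leaf lifted from below \<open>x\<close> compares as before, since its
  larger siblings were lifted too.\<close>

lemma young_leaf_up_edge: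
  assumes less: "\<And>u j w. (u, j, w) \<in> R \<Longrightarrow> u < w"
    and x: "(p, i, x) \<in> R" "\<And>j w. (p, j, w) \<in> R \<Longrightarrow> w \<le> x" "(x, j0, w0) \<in> R"
  shows "young_leaf (up_edge p x ` R) = insert x (young_leaf R)"
proof (intro equalityI subsetI)
  fix y assume "y \<in> young_leaf (up_edge p x ` R)"
  then obtain q l j w where y: "(q, l, y) \<in> up_edge p x ` R" "(q, j, w) \<in> up_edge p x ` R" "y < w"
    "\<And>j w. (y, j, w) \<notin> up_edge p x ` R"
    unfolding young_leaf_def by blast
  show "y \<in> insert x (young_leaf R)"
  proof (cases "y = x")
    case False
    then have out: "\<And>j w. (y, j, w) \<notin> R" using y(4) unfolding up_edge_image_iff by blast
    have "\<exists>q l j w. (q, l, y) \<in> R \<and> (q, j, w) \<in> R \<and> y < w"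
    proof (cases "q \<noteq> x \<and> (q, l, y) \<in> R")
      case True
      then have "(q, j, w) \<in> R \<or> q = p" using y(2) unfolding up_edge_image_iff by blast
      then show ?thesis
      proof
        assume "q = p"
        then have "y < x" using x(2)[of l y] True \<open>y \<noteq> x\<close> by simp
        then show ?thesis using True x(1) \<open>q = p\<close> by blast
      qed (use True y(3) in blast)
    next
      case False
      then have q: "q = p" "(x, l, y) \<in> R" using y(1) unfolding up_edge_image_iff by blast+
      \<comment> \<open>The original targets of \<open>p\<close> are at most \<open>x\<close>, and
        \<open>x < y\<close>, so a sibling greater than \<open>y\<close> must itself come from below
        \<open>x\<close>.\<close>
      then have "(p, j, w) \<notin> R" using less[OF q(2)] x(2)[of j w] y(3) by auto
      then have "(x, j, w) \<in> R" using y(2) q unfolding up_edge_image_iff by blast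
      then show ?thesis using q y(3) by blast
    qed
    then show ?thesis using out unfolding young_leaf_def by blast
  qed simp
next
  have px: "p < x" using less x(1) .
  fix y assume "y \<in> insert x (young_leaf R)"
  then consider "y = x" | q l j w where "y \<noteq> x" "(q, l, y) \<in> R" "(q, j, w) \<in> R" "y < w" "\<And>j w. (y, j, w) \<notin> R"
    using x(3) unfolding young_leaf_def by blast
  then show "y \<in> young_leaf (up_edge p x ` R)"
  proof cases
    case 1
    have "(p, i, x) \<in> up_edge p x ` R" "(p, j0, w0) \<in> up_edge p x ` R" "\<And>j w. (x, j, w) \<notin> up_edge p x ` R"
      using x(1,3) px unfolding up_edge_image_iff by auto
    then show ?thesis using 1 less[OF x(3)] unfolding young_leaf_def by blast
  next
    case 2
    then have "\<And>j w. (y, j, w) \<notin> up_edge p x ` R" using x(1) unfolding up_edge_image_iff by blast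
    moreover have "(if q = x then p else q, l, y) \<in> up_edge p x ` R" "(if q = x then p else q, j, w) \<in> up_edge p x ` R"
      using 2(2,3) unfolding up_edge_image_iff by auto
    ultimately show ?thesis using 2(4) unfolding young_leaf_def by blast
  qed
qed

section \<open>From edge sets back to \<open>Phi\<close>\<close>

lemma distinct_subtree: "distinct (labels T) \<Longrightarrow> v \<in> subtrees T \<Longrightarrow> distinct (labels v)"
proof (induction T)
  case (ENode a cs)
  note D = distinct_labels_ENode[OF ENode.prems(1)]
  from ENode.prems(2) consider "v = ENode a cs" | c t where "c \<in> set cs" "t \<in> set c" "v \<in> subtrees t"
    by auto
  then show ?case
  proof cases
    case 1 then show ?thesis using ENode.prems(1) by simp
  next
    case 2
    then have "t \<in> set (concat cs)" by auto
    with 2 D(2) ENode.IH show ?thesis by blast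
  qed
qed

text \<open>Images with a common target come from edges with that same target, and functionality
  makes those edges equal. Injectivity of \<open>\<phi>\<close> does not enter.\<close>

lemma functional_image:
  assumes "functional R" "\<And>u j w. \<exists>u'. \<phi> (u, j, w) = (u', j, w)"
  shows "functional (\<phi> ` R)"
  unfolding functional_def
proof (intro allI impI, elim conjE)
  fix u i v j w assume *: "(u, i, w) \<in> \<phi> ` R" "(v, j, w) \<in> \<phi> ` R"
  have "\<exists>a. (a, l, w) \<in> R \<and> \<phi> (a, l, w) = (b, l, w)" if "(b, l, w) \<in> \<phi> ` R" for b l
    using that assms(2) by (auto simp: image_iff) (metis prod.inject)
  then obtain a b where ab: "(a, i, w) \<in> R" "\<phi> (a, i, w) = (u, i, w)" "(b, j, w) \<in> R" "\<phi> (b, j, w) = (v, j, w)"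
    using * by meson
  then show "u = v \<and> i = j" using assms(1) unfolding functional_def by (metis prod.inject)
qed

lemma targets_image:
  assumes "\<And>u j w. \<exists>u'. \<phi> (u, j, w) = (u', j, w)"
  shows "(\<exists>u j. (u, j, w) \<in> \<phi> ` R) \<longleftrightarrow> (\<exists>u j. (u, j, w) \<in> R)"
proof
  assume "\<exists>u j. (u, j, w) \<in> \<phi> ` R"
  then show "\<exists>u j. (u, j, w) \<in> R" using assms by (auto simp: image_iff) (metis prod.inject)
next
  assume "\<exists>u j. (u, j, w) \<in> R"
  then show "\<exists>u j. (u, j, w) \<in> \<phi> ` R" using assms by (metis image_eqI)
qed

lemma up_edge_target: "\<exists>u'. up_edge p x (u, j, w) = (u', j, w)"
  unfolding up_edge_def by simp

lemma down_edge_target: "\<exists>u'. down_edge p x (u, j, w) = (u', j, w)"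
  unfolding down_edge_def by simp

lemma grand_children_lab_edge:
  assumes "valid k T" "ENode p cs \<in> subtrees T" "(p, i, w) \<in> edges T"
  shows "\<exists>t\<in>set (concat cs). lab t = w"
  using assms out_edges[of T "ENode p cs" i w]
    unfolding valid_def by (metis etree.sel image_iff in_set_concat_nth)

lemma edge_grand_children:
  assumes "valid k T" "ENode p cs \<in> subtrees T" "t \<in> set (concat cs)"
  shows "t \<in> subtrees T" "\<exists>i. (p, i, lab t) \<in> edges T"
  using grand_child_edge[OF assms(1,2), of t] assms(3) unfolding grand_children_def by auto

lemma Phi_old:
  assumes T: "valid k T" and x: "x \<in> Oint_tree T" "(p, i, x) \<in> edges T"
  shows "valid k (Phi x T)" "lab (Phi x T) = lab T" "edges (Phi x T) = up_edge p x ` edges T"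
proof -
  have R: "regular k T" "distinct (labels T)" using T unfolding valid_def by auto
  note F = functional_edges[OF R(2)]
  obtain max: "\<And>j w. (p, j, w) \<in> edges T \<Longrightarrow> w \<le> x" and out: "\<exists>j w. (x, j, w) \<in> edges T"
    using x F unfolding Oint_tree_edges[OF T] old_int_def functional_def by blast
  have "regular k (lift_up x U) \<and> lab (lift_up x U) = p \<and> edges (lift_up x U) = up_edge p x ` edges U"
    if U: "U \<in> subtrees T" "lab U = p" for U
  proof -
    obtain cs where cs: "U = ENode p cs" using U(2) by (cases U) auto
    note U' = U(1)[unfolded cs]
    obtain v where v: "v \<in> set (concat cs)" "lab v = x"
      using grand_children_lab_edge[OF T U' x(2)] by blast
    have "kids v \<noteq> []"
      using kids_nonempty_iff[OF R] edge_grand_children(1)[OF T U' v(1)] v(2) out by blast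
    then show ?thesis unfolding cs
      using lift_up_edges[OF regular_subtree[OF R(1) U'] distinct_subtree[OF R(2) U'] v]
        edge_grand_children(2)[OF T U'] max by blast
  qed
  moreover have "up_edge p x (u, j, w) = (u, j, w)" if "u \<noteq> p" "u \<noteq> x" for u j w
    using that unfolding up_edge_def by simp
  ultimately have *: "regular k (Phi x T) \<and> lab (Phi x T) = lab T \<and> edges (Phi x T) = up_edge p x ` edges T"
    using at_grand_parent_edges[OF R x(2), of "lift_up x" "up_edge p x"] x(1) unfolding Phi_def by simp
  then show "lab (Phi x T) = lab T" "edges (Phi x T) = up_edge p x ` edges T" by auto
  have "functional (edges (Phi x T))" using functional_image[OF F up_edge_target] * by simp
  then show "valid k (Phi x T)" using * distinct_labels_if_functional unfolding valid_def by blast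
qed

lemma Phi_young:
  assumes T: "valid k T" and x: "x \<in> Yleaf_tree T" "(p, i, x) \<in> edges T"
  shows "valid k (Phi x T)" "lab (Phi x T) = lab T" "edges (Phi x T) = down_edge p x ` edges T"
proof -
  have R: "regular k T" "distinct (labels T)" using T unfolding valid_def by auto
  note F = functional_edges[OF R(2)]
  obtain young: "\<exists>j w. (p, j, w) \<in> edges T \<and> x < w" and out: "\<And>j w. (x, j, w) \<notin> edges T"
    using x F unfolding Yleaf_tree_edges[OF T] young_leaf_def functional_def by blast
  \<comment> \<open>\<open>Phi\<close> tests for old internal labels first, so this exclusion is
    what selects its push-down branch.\<close>
  have "x \<notin> Oint_tree T" using out unfolding Oint_tree_edges[OF T] old_int_def by blast
  have "regular k (push_down x U) \<and> lab (push_down x U) = p \<and> edges (push_down x U) = down_edge p x ` edges U"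
    if U: "U \<in> subtrees T" "lab U = p" for U
  proof -
    obtain cs where cs: "U = ENode p cs" using U(2) by (cases U) auto
    note U' = U(1)[unfolded cs]
    obtain v where v: "v \<in> set (concat cs)" "lab v = x"
      using grand_children_lab_edge[OF T U' x(2)] by blast
    have "kids v = []" using kids_nonempty_iff[OF R] edge_grand_children(1)[OF T U' v(1)] v(2) out
      by blast
    moreover obtain t where "t \<in> set (concat cs)" "x < lab t"
      using grand_children_lab_edge[OF T U'] young by metis
    ultimately show ?thesis unfolding cs
      using push_down_edges[OF regular_subtree[OF R(1) U'] distinct_subtree[OF R(2) U'] v] by blast
  qed
  moreover have "down_edge p x (u, j, w) = (u, j, w)" if "u \<noteq> p" "u \<noteq> x" for u j w
    using that unfolding down_edge_def by simp
  ultimately have *: "regular k (Phi x T) \<and> lab (Phi x T) = lab T \<and> edges (Phi x T) = down_edge p x ` edges T"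
    using at_grand_parent_edges[OF R x(2), of "push_down x" "down_edge p x"] x(1) \<open>x \<notin> Oint_tree T\<close>
    unfolding Phi_def by simp
  then show "lab (Phi x T) = lab T" "edges (Phi x T) = down_edge p x ` edges T" by auto
  have "functional (edges (Phi x T))" using functional_image[OF F down_edge_target] * by simp
  then show "valid k (Phi x T)" using * distinct_labels_if_functional unfolding valid_def by blast
qed

section \<open>Involution and commutation\<close>

lemma Oint_Yleaf_tree_disjoint: "valid k T \<Longrightarrow> Oint_tree T \<inter> Yleaf_tree T = {}"
  unfolding Oint_tree_edges Yleaf_tree_edges old_int_def young_leaf_def by blast

lemma Oint_Yleaf_tree_edge:
  assumes "valid k T" "x \<in> Oint_tree T \<union> Yleaf_tree T"
  shows "\<exists>p i. (p, i, x) \<in> edges T"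
  using assms(2) unfolding Oint_tree_edges[OF assms(1)] Yleaf_tree_edges[OF assms(1)] old_int_def young_leaf_def
  by blast

lemma Oint_Yleaf_tree_labels:
  assumes "valid k T" shows "Oint_tree T \<union> Yleaf_tree T \<subseteq> set (labels T)"
  using Oint_Yleaf_tree_edge[OF assms] edge_target by blast

lemma root_not_Oint_Yleaf:
  assumes "valid k T" shows "lab T \<notin> Oint_tree T \<union> Yleaf_tree T"
  using Oint_Yleaf_tree_edge[OF assms] edge_not_to_root[of T] assms unfolding valid_def by blast

lemma valid_eqI:
  "valid k T \<Longrightarrow> valid k T' \<Longrightarrow> lab T = lab T' \<Longrightarrow> edges T = edges T' \<Longrightarrow> T = T'"
  unfolding valid_def using tree_eqI by blast

text \<open>All items follow from the edge description in \<open>Phi_old\<close>. For the last one,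
  \<open>x\<close> is a young leaf after the lift, so the second application pushes down, and
  \<open>down_up_edge\<close> restores the edges.\<close>

lemma Phi_Oint:
  assumes T: "valid k T" and x: "x \<in> Oint_tree T"
  shows "valid k (Phi x T)" "lab (Phi x T) = lab T" "set (labels (Phi x T)) = set (labels T)"
    "leaf (Phi x T) \<longleftrightarrow> leaf T" "Oint_tree (Phi x T) = Oint_tree T - {x}"
    "Yleaf_tree (Phi x T) = insert x (Yleaf_tree T)" "Phi x (Phi x T) = T"
proof -
  obtain p i where p: "(p, i, x) \<in> edges T" using Oint_Yleaf_tree_edge[OF T] x by blast
  note P = Phi_old[OF T x p]
  have R: "regular k T" "distinct (labels T)" using T unfolding valid_def by auto
  note F = functional_edges[OF R(2)]
  note less = edge_less[OF R(1)]
  have px: "p < x" using less[OF p] .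
  obtain j0 w0 where max: "\<And>j w. (p, j, w) \<in> edges T \<Longrightarrow> w \<le> x" and out: "(x, j0, w0) \<in> edges T"
    using x p F unfolding Oint_tree_edges[OF T] old_int_def functional_def by blast
  show "valid k (Phi x T)" "lab (Phi x T) = lab T" by fact+
  show "set (labels (Phi x T)) = set (labels T)"
    unfolding set_labels_edges P using targets_image[OF up_edge_target] by auto
  \<comment> \<open>Only \<open>x\<close> loses outgoing edges and only \<open>p\<close> can gain
    any. The root is not \<open>x\<close>, and if it is \<open>p\<close> it already has the edge to
    \<open>x\<close>; so its being a leaf is unaffected.\<close>
  have "lab T \<noteq> x" using root_not_Oint_Yleaf[OF T] x by blast
  then show "leaf (Phi x T) \<longleftrightarrow> leaf T"
    unfolding leaf_iff[OF P(1) self_in_subtrees] leaf_iff[OF T self_in_subtrees] P up_edge_image_iff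
    using p by blast
  show "Oint_tree (Phi x T) = Oint_tree T - {x}"
    unfolding Oint_tree_edges[OF P(1)] Oint_tree_edges[OF T] P(3)
      by (rule old_int_up_edge[OF less p max])
  show Y: "Yleaf_tree (Phi x T) = insert x (Yleaf_tree T)"
    unfolding Yleaf_tree_edges[OF P(1)] Yleaf_tree_edges[OF T] P(3)
      by (rule young_leaf_up_edge[OF less p max out])
  \<comment> \<open>The edge into \<open>x\<close> keeps its source, so the way back uses the same
    grand parent \<open>p\<close>.\<close>
  have "(p, i, x) \<in> edges (Phi x T)" unfolding P up_edge_image_iff using p px by simp
  note Q = Phi_young[OF P(1) _ this]
  have xY: "x \<in> Yleaf_tree (Phi x T)" using Y by simp
  have "edges (Phi x (Phi x T)) = edges T"
    unfolding Q(3)[OF xY] P(3) using down_up_edge[OF px max less] .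
  then show "Phi x (Phi x T) = T" using valid_eqI[OF Q(1)[OF xY] T] Q(2)[OF xY] P(2) by simp
qed

text \<open>Only the facts needed to turn a push into a reversed lift are shown;
  \<open>Phi_toggle\<close> obtains the remaining ones by applying \<open>Phi_Oint\<close> to
  \<open>Phi x T\<close>.\<close>

lemma Phi_Yleaf:
  assumes T: "valid k T" and x: "x \<in> Yleaf_tree T"
  shows "valid k (Phi x T)" "x \<in> Oint_tree (Phi x T)" "Phi x (Phi x T) = T"
proof -
  obtain p i where p: "(p, i, x) \<in> edges T" using Oint_Yleaf_tree_edge[OF T] x by blast
  note P = Phi_young[OF T x p]
  have R: "regular k T" "distinct (labels T)" using T unfolding valid_def by auto
  have px: "p < x" using edge_less[OF R(1) p] .
  obtain j0 w0 where young: "(p, j0, w0) \<in> edges T" "x < w0" and out: "\<And>j w. (x, j, w) \<notin> edges T"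
    using x p functional_edges[OF R(2)]
      unfolding Yleaf_tree_edges[OF T] young_leaf_def functional_def by blast
  show "valid k (Phi x T)" by fact
  have p': "(p, i, x) \<in> edges (Phi x T)" unfolding P down_edge_image_iff using p by simp
  moreover have "(x, j0, w0) \<in> edges (Phi x T)" unfolding P down_edge_image_iff using young by simp
  moreover have "w \<le> x" if "(p, j, w) \<in> edges (Phi x T)" for j w
    using that px unfolding P down_edge_image_iff by auto
  ultimately show xO: "x \<in> Oint_tree (Phi x T)" unfolding Oint_tree_edges[OF P(1)] old_int_def by blast
  note Q = Phi_old[OF P(1) xO p']
  have "edges (Phi x (Phi x T)) = edges T"
    unfolding Q(3) P(3) using up_down_edge[OF px out] .
  then show "Phi x (Phi x T) = T" using valid_eqI[OF Q(1) T] Q(2) P(2) by simp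
qed

lemma Phi_trivial: "x \<notin> Oint_tree T \<union> Yleaf_tree T \<Longrightarrow> Phi x T = T"
  unfolding Phi_def by simp

text \<open>One description for all three branches of \<open>Phi\<close>: \<open>x\<close> changes
  class if it belongs to one of the two, and nothing else changes class. Later arguments need only
  this set calculus.\<close>

lemma Phi_toggle:
  assumes T: "valid k T"
  shows "valid k (Phi x T)" "lab (Phi x T) = lab T" "set (labels (Phi x T)) = set (labels T)"
    "leaf (Phi x T) \<longleftrightarrow> leaf T" "Phi x (Phi x T) = T"
    "Oint_tree (Phi x T) = Oint_tree T - {x} \<union> (Yleaf_tree T \<inter> {x})"
    "Yleaf_tree (Phi x T) = Yleaf_tree T - {x} \<union> (Oint_tree T \<inter> {x})"
proof -
  have "valid k (Phi x T) \<and> lab (Phi x T) = lab T \<and> set (labels (Phi x T)) = set (labels T) \<and>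
    (leaf (Phi x T) \<longleftrightarrow> leaf T) \<and> Phi x (Phi x T) = T \<and>
    Oint_tree (Phi x T) = Oint_tree T - {x} \<union> (Yleaf_tree T \<inter> {x}) \<and>
    Yleaf_tree (Phi x T) = Yleaf_tree T - {x} \<union> (Oint_tree T \<inter> {x})"
  proof -
    consider "x \<in> Oint_tree T" | "x \<in> Yleaf_tree T" | "x \<notin> Oint_tree T \<union> Yleaf_tree T" by blast
    then show ?thesis
    proof cases
      case 1
      then have "x \<notin> Yleaf_tree T" using Oint_Yleaf_tree_disjoint[OF T] by blast
      with 1 Phi_Oint[OF T 1] show ?thesis by auto
    next
      case 2
      note Y = Phi_Yleaf[OF T 2]
      \<comment> \<open>Since lifting \<open>x\<close> in \<open>Phi x T\<close> gives back
        \<open>T\<close>, the lift from \<open>Phi x T\<close> to \<open>T\<close> is read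
        backwards.\<close>
      note O = Phi_Oint[OF Y(1,2), unfolded Y(3)]
      have "x \<notin> Yleaf_tree (Phi x T)" "x \<notin> Oint_tree T"
        using Y Oint_Yleaf_tree_disjoint[OF Y(1)] Oint_Yleaf_tree_disjoint[OF T] 2 by blast+
      with O Y 2 show ?thesis by auto
    next
      case 3
      then show ?thesis using Phi_trivial[OF 3] T by simp
    qed
  qed
  then show "valid k (Phi x T)" "lab (Phi x T) = lab T" "set (labels (Phi x T)) = set (labels T)"
    "leaf (Phi x T) \<longleftrightarrow> leaf T" "Phi x (Phi x T) = T"
    "Oint_tree (Phi x T) = Oint_tree T - {x} \<union> (Yleaf_tree T \<inter> {x})"
    "Yleaf_tree (Phi x T) = Yleaf_tree T - {x} \<union> (Oint_tree T \<inter> {x})"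
    by blast+
qed

lemma Phi_commute_Oint:
  assumes T: "valid k T" and xy: "x \<in> Oint_tree T" "y \<in> Oint_tree T" "x \<noteq> y"
  shows "Phi x (Phi y T) = Phi y (Phi x T)"
proof -
  obtain p i q j where p: "(p, i, x) \<in> edges T" and q: "(q, j, y) \<in> edges T"
    using Oint_Yleaf_tree_edge[OF T] xy(1,2) by blast
  have less: "p < x" "q < y" using T p q edge_less unfolding valid_def by blast+
  note X = Phi_old[OF T xy(1) p] and Y = Phi_old[OF T xy(2) q]
  have xO: "x \<in> Oint_tree (Phi y T)" and yO: "y \<in> Oint_tree (Phi x T)"
    using Phi_Oint(5)[OF T] xy by auto
  \<comment> \<open>The second lift must use the grand parent valid after the first one, which
    differs when one of \<open>x\<close> and \<open>y\<close> is the grand parent of the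
    other.\<close>
  have "(if p = y then q else p, i, x) \<in> edges (Phi y T)" "(if q = x then p else q, j, y) \<in> edges (Phi x T)"
    unfolding X Y up_edge_image_iff using p q by auto
  note YX = Phi_old[OF X(1) yO this(2)] and XY = Phi_old[OF Y(1) xO this(1)]
  have "edges (Phi x (Phi y T)) = edges (Phi y (Phi x T))"
    unfolding XY(3) YX(3) X(3) Y(3) using up_edge_commute[OF less xy(3)] .
  then show ?thesis using valid_eqI[OF XY(1) YX(1)] XY(2) YX(2) X(2) Y(2) by simp
qed

text \<open>The edge computation is made for two lifts only; the cases involving young leaves are
  reduced to it by the involution property.\<close>

lemma Phi_commute:
  assumes T: "valid k T"
  shows "Phi x (Phi y T) = Phi y (Phi x T)"
proof -
  note V = Phi_toggle(1) and I = Phi_toggle(5)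
  \<comment> \<open>Push young leaves down first, commute the lifts, and undo the push.\<close>
  have mixed: "Phi x (Phi y T) = Phi y (Phi x T)"
    if "valid k T" "x \<in> Oint_tree T" "y \<in> Yleaf_tree T" "x \<noteq> y" for x y T
  proof -
    have "x \<in> Oint_tree (Phi y T)" "y \<in> Oint_tree (Phi y T)" using that Phi_toggle(6)[OF that(1)] by auto
    then have "Phi x (Phi y (Phi y T)) = Phi y (Phi x (Phi y T))"
      using Phi_commute_Oint[OF V[OF that(1)]] that(4) by blast
    then have "Phi x T = Phi y (Phi x (Phi y T))" using I[OF that(1)] by simp
    then show ?thesis using I[OF V[OF V[OF that(1)]]] by simp
  qed
  \<comment> \<open>In \<open>Phi x T\<close> the label \<open>x\<close> is old internal and
    \<open>y\<close> still a young leaf. The mixed case applies to that tree, and cancelling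
    repeated \<open>Phi x\<close> gives the claim.\<close>
  have young: "Phi x (Phi y T) = Phi y (Phi x T)"
    if "x \<in> Yleaf_tree T" "y \<in> Yleaf_tree T" "x \<noteq> y"
  proof -
    have "x \<in> Oint_tree (Phi x T)" "y \<in> Yleaf_tree (Phi x T)" using that Phi_toggle(6,7)[OF T] by auto
    then have "Phi x (Phi y (Phi x T)) = Phi y (Phi x (Phi x T))"
      using mixed[OF V[OF T]] that(3) by blast
    then have "Phi x (Phi y (Phi x T)) = Phi y T" using I[OF T] by simp
    then show ?thesis using I[OF V[OF V[OF T]]] by metis
  qed
  have trivial: "Phi x (Phi y T) = Phi y (Phi x T)" if "x \<notin> Oint_tree T \<union> Yleaf_tree T" for x y
  proof -
    have "x \<notin> Oint_tree (Phi y T) \<union> Yleaf_tree (Phi y T)" using that Phi_toggle(6,7)[OF T] by blast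
    then show ?thesis using that Phi_trivial by simp
  qed
  consider "x = y" | "x \<notin> Oint_tree T \<union> Yleaf_tree T" | "y \<notin> Oint_tree T \<union> Yleaf_tree T"
    | "x \<noteq> y" "x \<in> Oint_tree T" "y \<in> Oint_tree T" | "x \<noteq> y" "x \<in> Oint_tree T" "y \<in> Yleaf_tree T"
    | "x \<noteq> y" "x \<in> Yleaf_tree T" "y \<in> Oint_tree T" | "x \<noteq> y" "x \<in> Yleaf_tree T" "y \<in> Yleaf_tree T"
      by blast
  then show ?thesis
  proof cases
    case 2 then show ?thesis using trivial by blast
  next
    case 3 then show ?thesis using trivial[of y x] by simp
  next
    case 4 then show ?thesis using Phi_commute_Oint[OF T] by blast
  next
    case 5 then show ?thesis using mixed[OF T] by blast
  next
    case 6 then show ?thesis using mixed[OF T, of y x] by simp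
  next
    case 7 then show ?thesis using young by blast
  qed simp
qed

text \<open>\<open>Phi\<close> commutes on valid trees only; totalising it by the identity puts it in the scope of the
  fold lemmas for commuting functions.\<close>

definition Phi_valid :: "nat \<Rightarrow> nat \<Rightarrow> etree \<Rightarrow> etree" where
  "Phi_valid k x T = (if valid k T then Phi x T else T)"

lemma comp_fun_commute_Phi_valid: "comp_fun_commute (Phi_valid k)"
  by unfold_locales (auto simp: fun_eq_iff Phi_valid_def Phi_toggle(1) Phi_commute)

text \<open>Validity is preserved at every stage, so the fold never meets a tree on which
  \<open>Phi\<close> and its totalised version differ.\<close>

lemma Phi_tree_fold:
  assumes "valid k T" shows "Phi_tree S T = Finite_Set.fold (Phi_valid k) T S"
  unfolding Phi_tree_def
  by (rule fold_closed_eq[where B = "{T. valid k T}"]) (use assms in \<open>auto simp: Phi_valid_def Phi_toggle(1)\<close>)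

text \<open>Each label of \<open>S\<close> is toggled exactly once, and toggling one label does not
  affect the class of another. This works for every finite \<open>S\<close>, including sets mixing
  both classes.\<close>

lemma Phi_tree_toggle:
  assumes "finite S" and T: "valid k T"
  shows "valid k (Phi_tree S T)" "lab (Phi_tree S T) = lab T" "set (labels (Phi_tree S T)) = set (labels T)"
    "leaf (Phi_tree S T) \<longleftrightarrow> leaf T" "Phi_tree S (Phi_tree S T) = T"
    "Oint_tree (Phi_tree S T) = Oint_tree T - S \<union> (Yleaf_tree T \<inter> S)"
    "Yleaf_tree (Phi_tree S T) = Yleaf_tree T - S \<union> (Oint_tree T \<inter> S)"
proof -
  interpret comp_fun_commute "Phi_valid k" by (rule comp_fun_commute_Phi_valid)
  let ?f = "\<lambda>S T. Finite_Set.fold (Phi_valid k) T S"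
  have *: "valid k (?f S T) \<and> lab (?f S T) = lab T \<and> set (labels (?f S T)) = set (labels T) \<and>
      (leaf (?f S T) \<longleftrightarrow> leaf T) \<and> ?f S (?f S T) = T \<and>
      Oint_tree (?f S T) = Oint_tree T - S \<union> (Yleaf_tree T \<inter> S) \<and>
      Yleaf_tree (?f S T) = Yleaf_tree T - S \<union> (Oint_tree T \<inter> S)"
    using assms(1)
  proof (induction S rule: finite_induct)
    case empty
    then show ?case using T by simp
  next
    case (insert x S)
    let ?U = "?f S T"
    have U: "valid k ?U" and UT: "?f S ?U = T" using insert.IH by auto
    have fx: "?f (insert x S) V = Phi_valid k x (?f S V)" for V using insert.hyps by simp
    have PV: "Phi_valid k x V = Phi x V" if "valid k V" for V using that by (simp add: Phi_valid_def)
    have "?f (insert x S) T = Phi x ?U" unfolding fx by (rule PV[OF U])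
    moreover have "?f (insert x S) (Phi x ?U) = T"
    proof -
      have "?f (insert x S) (Phi x ?U) = Phi_valid k x (?f S (Phi_valid k x ?U))"
        unfolding fx PV[OF U] ..
      \<comment> \<open>Moving the inner \<open>x\<close> past the fold over \<open>S\<close> lets
        the induction hypothesis undo \<open>S\<close>; the two copies of \<open>x\<close> then
        cancel.\<close>
      also have "\<dots> = Phi_valid k x (Phi_valid k x (?f S ?U))"
        using fold_fun_left_comm[OF insert.hyps(1)] by simp
      also have "\<dots> = T" unfolding UT using T by (simp add: PV Phi_toggle(1,5))
      finally show ?thesis .
    qed
    moreover have "Oint_tree (Phi x ?U) = Oint_tree T - insert x S \<union> (Yleaf_tree T \<inter> insert x S)"
      "Yleaf_tree (Phi x ?U) = Yleaf_tree T - insert x S \<union> (Oint_tree T \<inter> insert x S)"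
      using Phi_toggle(6,7)[OF U, of x] insert.IH insert.hyps(2) by blast+
    ultimately show ?case using Phi_toggle(1-4)[OF U, of x] insert.IH by simp
  qed
  note eq = Phi_tree_fold[OF T]
  from * show V: "valid k (Phi_tree S T)" unfolding eq by blast
  from * show "lab (Phi_tree S T) = lab T" "set (labels (Phi_tree S T)) = set (labels T)"
    "leaf (Phi_tree S T) \<longleftrightarrow> leaf T"
    "Oint_tree (Phi_tree S T) = Oint_tree T - S \<union> (Yleaf_tree T \<inter> S)"
    "Yleaf_tree (Phi_tree S T) = Yleaf_tree T - S \<union> (Oint_tree T \<inter> S)"
    unfolding eq by blast+
  \<comment> \<open>The outer fold starts at \<open>Phi_tree S T\<close>, so validity of that tree,
    supplied by \<open>V\<close>, is used to totalise it before the inner one.\<close>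
  from * show "Phi_tree S (Phi_tree S T) = T" unfolding Phi_tree_fold[OF V] unfolding eq by blast
qed

section \<open>Forests\<close>

lemma forests_iff:
  "F \<in> forests n k \<longleftrightarrow>
     (\<forall>T\<in>set F. valid k T \<and> 0 \<notin> set (labels T)) \<and>
     sorted_wrt (\<lambda>T U. set (labels T) \<inter> set (labels U) = {}) F \<and>
     (\<Union>T\<in>set F. set (labels T)) = {1..n} \<and> sorted_wrt (<) (map lab F)"
  unfolding forests_def by (simp add: inc_trees_iff)

text \<open>The trees change independently, and each keeps its root label and label set, which are
  all that the conditions linking different trees mention.\<close>

lemma Phi_forest_toggle:
  assumes F: "F \<in> forests n k"
  shows "Phi_forest S F \<in> forests n k" "Phi_forest S (Phi_forest S F) = F"
    "Oint (Phi_forest S F) = Oint F - S \<union> (Yleaf F \<inter> S)"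
    "Yleaf (Phi_forest S F) = Yleaf F - S \<union> (Oint F \<inter> S)"
    "Si (Phi_forest S F) = Si F"
proof -
  let ?g = "\<lambda>T. Phi_tree (S \<inter> set (labels T)) T"
  have eq: "Phi_forest S F = map ?g F" unfolding Phi_forest_def ..
  have V: "valid k T" if "T \<in> set F" for T using F that unfolding forests_iff by blast
  note G = Phi_tree_toggle[OF finite_Int[OF disjI2[OF finite_set]] V]
  show "Phi_forest S F \<in> forests n k"
  proof -
    have "map lab (map ?g F) = map lab F" using G(2) by simp
    moreover have "sorted_wrt (\<lambda>T U. set (labels T) \<inter> set (labels U) = {}) (map ?g F)"
      using F unfolding forests_iff by (simp add: sorted_wrt_iff_nth_less G(3))
    ultimately show ?thesis using F unfolding forests_iff eq by (auto simp: G(1,3) simp del: map_map)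
  qed
  \<comment> \<open>As label sets are kept, the second application gives each tree the same part of
    \<open>S\<close> as the first.\<close>
  show "Phi_forest S (Phi_forest S F) = F"
    unfolding eq unfolding Phi_forest_def by (simp add: map_idI G(3,5))
  have "Oint_tree (?g T) = Oint_tree T - S \<union> (Yleaf_tree T \<inter> S)"
    "Yleaf_tree (?g T) = Yleaf_tree T - S \<union> (Oint_tree T \<inter> S)" if "T \<in> set F" for T
    using G(6,7)[OF that] Oint_Yleaf_tree_labels[OF V[OF that]] by blast+
  then show "Oint (Phi_forest S F) = Oint F - S \<union> (Yleaf F \<inter> S)"
    "Yleaf (Phi_forest S F) = Yleaf F - S \<union> (Oint F \<inter> S)"
    unfolding Oint_def Yleaf_def eq by auto
  show "Si (Phi_forest S F) = Si F"
  proof -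
    have "Si (map ?g F) = {x. \<exists>T\<in>set F. x = lab (?g T) \<and> leaf (?g T)}" unfolding Si_def by auto
    also have "\<dots> = {x. \<exists>T\<in>set F. x = lab T \<and> leaf T}" using G(2,4) by simp
    also have "\<dots> = Si F" unfolding Si_def by blast
    finally show ?thesis unfolding eq .
  qed
qed

lemma Si_star_Phi_forest:
  assumes F: "F \<in> forests n k" and "n \<ge> 1"
  shows "Si_star (Phi_forest S F) = Si_star F"
proof -
  \<comment> \<open>\<open>last\<close> is unspecified on the empty list; a nonempty label set
    \<open>{1..n}\<close> guarantees an actual last tree.\<close>
  have ne: "F \<noteq> []" using F assms(2) unfolding forests_iff by auto
  have "valid k (last F)" using F ne unfolding forests_iff by simp
  note G = Phi_tree_toggle[OF finite_Int[OF disjI2[OF finite_set]] this]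
  have "last (Phi_forest S F) = Phi_tree (S \<inter> set (labels (last F))) (last F)"
    unfolding Phi_forest_def using ne by (simp add: last_map)
  then show ?thesis unfolding Si_star_def using Phi_forest_toggle(5)[OF F] G(2,4) by simp
qed

lemma forests_tree_unique:
  assumes "F \<in> forests n k" "T \<in> set F" "U \<in> set F" "x \<in> set (labels T)" "x \<in> set (labels U)"
  shows "T = U"
proof -
  obtain i j where ij: "i < length F" "T = F ! i" "j < length F" "U = F ! j"
    using assms(2,3) unfolding in_set_conv_nth by blast
  have "set (labels (F ! a)) \<inter> set (labels (F ! b)) = {}" if "a < b" "b < length F" for a b
    using assms(1) that unfolding forests_iff sorted_wrt_iff_nth_less by blast
  then have "i = j" using ij assms(4,5) by (cases i j rule: linorder_cases) blast+
  then show ?thesis using ij by simp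
qed

lemma Oint_Yleaf_disjoint:
  assumes F: "F \<in> forests n k"
  shows "Oint F \<inter> Yleaf F = {}"
proof -
  have False if "T \<in> set F" "U \<in> set F" "x \<in> Oint_tree T" "x \<in> Yleaf_tree U" for T U x
  proof -
    have V: "valid k T" "valid k U" using F that unfolding forests_iff by blast+
    have "T = U"
      using forests_tree_unique[OF F that(1,2)] Oint_Yleaf_tree_labels[OF V(1)] Oint_Yleaf_tree_labels[OF V(2)] that(3,4)
      by blast
    then show False using Oint_Yleaf_tree_disjoint[OF V(1)] that(3,4) by blast
  qed
  then show ?thesis unfolding Oint_def Yleaf_def by blast
qed

text \<open>Singletons are roots. A root label is never the target of an edge, whereas old and young
  labels are targets, and different trees share no labels.\<close>

lemma Si_star_disjoint:
  assumes F: "F \<in> forests n k"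
  shows "Si_star F \<inter> (Oint F \<union> Yleaf F) = {}"
proof -
  have False if "T \<in> set F" "U \<in> set F" "lab T \<in> Oint_tree U \<union> Yleaf_tree U" for T U
  proof -
    have U: "valid k U" using F that unfolding forests_iff by blast
    have "lab T \<in> set (labels U)" using that(3) Oint_Yleaf_tree_labels[OF U] by blast
    then have "T = U" using forests_tree_unique[OF F that(1,2)] lab_in_labels by blast
    then show False using root_not_Oint_Yleaf[OF U] that(3) by blast
  qed
  moreover have "Si_star F \<subseteq> lab ` set F" unfolding Si_star_def Si_def by auto
  ultimately show ?thesis unfolding Oint_def Yleaf_def by blast
qed

theorem proposition5p4:
  fixes n k :: nat
  assumes "n \<ge> 1" and "k \<ge> 1"
  shows "Theta \<in> XX n k \<rightarrow> YY n k \<and>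
         Theta' \<in> YY n k \<rightarrow> XX n k \<and>
         (\<forall>p\<in>XX n k. Theta' (Theta p) = p) \<and>
         (\<forall>q\<in>YY n k. Theta (Theta' q) = q) \<and>
         bij_betw Theta (XX n k) (YY n k)"
proof -
  have X: "Theta p \<in> YY n k \<and> Theta' (Theta p) = p" if p: "p \<in> XX n k" for p
  proof -
    obtain F S where p_def: "p = (F, S)" by (cases p)
    have F: "F \<in> forests n k" "Yleaf F = {}" "S \<subseteq> Oint F \<union> Si_star F" using p
      unfolding p_def XX_def by auto
    let ?G = "Phi_forest (S \<inter> Oint F) F"
    note G = Phi_forest_toggle[OF F(1), of "S \<inter> Oint F"]
    \<comment> \<open>\<open>F\<close> has no young leaves, so those of the image are exactly the
      lifted labels. \<open>Theta'\<close> thus pushes down the very set that \<open>Theta\<close>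
      lifted.\<close>
    have "Yleaf ?G = S \<inter> Oint F" using G(4) F(2) by blast
    moreover have "S \<inter> Si_star F \<union> S \<inter> Oint F = S" using F(3) by blast
    ultimately show ?thesis
      unfolding p_def Theta_def Theta'_def YY_def
      using G(1,2) Si_star_Phi_forest[OF F(1) assms(1)] by simp
  qed
  have Y: "Theta' q \<in> XX n k \<and> Theta (Theta' q) = q" if q: "q \<in> YY n k" for q
  proof -
    obtain F S where q_def: "q = (F, S)" by (cases q)
    have F: "F \<in> forests n k" "S \<subseteq> Si_star F" using q unfolding q_def YY_def by auto
    let ?G = "Phi_forest (Yleaf F) F"
    note G = Phi_forest_toggle[OF F(1), of "Yleaf F"]
    note D = Si_star_disjoint[OF F(1)] and Si = Si_star_Phi_forest[OF F(1) assms(1), of "Yleaf F"]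
    \<comment> \<open>All young leaves become old internal, and no label becomes a young leaf
      because old internal labels lie outside \<open>Yleaf F\<close>.\<close>
    have "Yleaf ?G = {}" "Yleaf F \<subseteq> Oint ?G" using G(3,4) Oint_Yleaf_disjoint[OF F(1)] by blast+
    moreover have "(S \<union> Yleaf F) \<inter> Oint ?G = Yleaf F" "(S \<union> Yleaf F) \<inter> Si_star ?G = S"
      \<comment> \<open>The union splits back without ambiguity: \<open>Si_star\<close> is unchanged
        by the move and is disjoint from both the old internal and the young leaf labels.\<close>
      using G(3) D F(2) Si by blast+
    ultimately show ?thesis
      unfolding q_def Theta_def Theta'_def XX_def
      using G(1,2) F(2) Si by auto
  qed
  have "bij_betw Theta (XX n k) (YY n k)"
    by (rule bij_betw_byWitness[where f' = Theta']) (use X Y in auto)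
  then show ?thesis using X Y by blast
qed

end
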